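(* Let $\Gamma$ be an arrangement of $n\geq 2$ pseudocircles. Then \[ v_0(\Gamma)\;\leq\; 2n+2f_0(\Gamma)-4. \]
   Context: A pseudocircle is a simple closed (Jordan) curve in the plane; $\mathrm{int}(\gamma)$ denotes its interior. An arrangement of pseudocircles is a finite set $\Gamma=\{\gamma_1,\dots,\gamma_n\}$ of pseudocircles such that no three of them pass through a common point, any two have at most two points in common, and at each common point of two of them the two curves cross. Vertices are the intersection points of pairs of pseudocircles; faces are the connected components of the complement of $\bigcup_i\gamma_i$ (including the unbounded one). The weight of a vertex or face is the number of $\gamma_i$ whose interior contains it. $v_0(\Gamma)$ is the number of vertices of weight $0$ and $f_0(\Gamma)$ the number of faces of weight $0$. *)

theory Defs
  imports "HOL-Analysis.Analysis"
begin

definition pseudocircle :: "complex set \<Rightarrow> bool" where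
  "pseudocircle \<gamma> \<longleftrightarrow>
     (\<exists>g. simple_path g \<and> pathfinish g = pathstart g \<and> path_image g = \<gamma>)"

definition crosses_at :: "complex set \<Rightarrow> complex set \<Rightarrow> complex \<Rightarrow> bool" where
  "crosses_at a b p \<longleftrightarrow>
     (\<exists>g. simple_path g \<and> pathfinish g = pathstart g \<and> path_image g = b \<and>
       (\<exists>t. 0 < t \<and> t < 1 \<and> g t = p \<and>
         (\<exists>e>0.
           ((\<forall>s. t - e < s \<and> s < t \<longrightarrow> g s \<in> inside a) \<and>
            (\<forall>s. t < s \<and> s < t + e \<longrightarrow> g s \<in> outside a)) \<or>
           ((\<forall>s. t - e < s \<and> s < t \<longrightarrow> g s \<in> outside a) \<and>
            (\<forall>s. t < s \<and> s < t + e \<longrightarrow> g s \<in> inside a)))))"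

definition arrangement :: "complex set set \<Rightarrow> bool" where
  "arrangement \<Gamma> \<longleftrightarrow>
     finite \<Gamma> \<and> (\<forall>\<gamma>\<in>\<Gamma>. pseudocircle \<gamma>) \<and>
     (\<forall>a\<in>\<Gamma>. \<forall>b\<in>\<Gamma>. \<forall>c\<in>\<Gamma>. a \<noteq> b \<and> a \<noteq> c \<and> b \<noteq> c \<longrightarrow> a \<inter> b \<inter> c = {}) \<and>
     (\<forall>a\<in>\<Gamma>. \<forall>b\<in>\<Gamma>. a \<noteq> b \<longrightarrow> finite (a \<inter> b) \<and> card (a \<inter> b) \<le> 2) \<and>
     (\<forall>a\<in>\<Gamma>. \<forall>b\<in>\<Gamma>. a \<noteq> b \<longrightarrow> (\<forall>p\<in>a \<inter> b. crosses_at a b p))"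

definition vertices :: "complex set set \<Rightarrow> complex set" where
  "vertices \<Gamma> = \<Union>{a \<inter> b | a b. a \<in> \<Gamma> \<and> b \<in> \<Gamma> \<and> a \<noteq> b}"

definition faces :: "complex set set \<Rightarrow> complex set set" where
  "faces \<Gamma> = components (- \<Union>\<Gamma>)"

definition point_weight :: "complex set set \<Rightarrow> complex \<Rightarrow> nat" where
  "point_weight \<Gamma> x = card {\<gamma>\<in>\<Gamma>. x \<in> inside \<gamma>}"

definition face_weight :: "complex set set \<Rightarrow> complex set \<Rightarrow> nat" where
  "face_weight \<Gamma> F = card {\<gamma>\<in>\<Gamma>. F \<subseteq> inside \<gamma>}"

definition v0 :: "complex set set \<Rightarrow> nat" where
  "v0 \<Gamma> = card {v \<in> vertices \<Gamma>. point_weight \<Gamma> v = 0}"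

definition f0 :: "complex set set \<Rightarrow> nat" where
  "f0 \<Gamma> = card {F \<in> faces \<Gamma>. face_weight \<Gamma> F = 0}"

end

theory Submission
  imports Defs "HOL-Library.Function_Algebras"
begin

text \<open>
  Call vertices and faces of weight 0 outer. For points \<open>w\<close>, \<open>w'\<close> in outer faces choose on every curve \<open>i\<close>
  a continuous branch \<open>L i\<close> of \<open>arg (z - w) - arg (z - w')\<close>. At an outer vertex \<open>u\<close> on the curves \<open>i\<close> and
  \<open>j\<close> put \<open>x u = L i u - L j u\<close>. Up to adding constants to the branches, these vectors depend only on the
  two faces, so together they span a space of dimension at most \<open>(n - 1) + (f0 - 1)\<close>. On the
  other hand, cutting along a maximal stretch of a curve that is covered by other discs gives such a vector
  supported exactly at the two outer vertices that end the stretch. Every outer vertex ends a stretch,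
  so there are at least \<open>v0 / 2\<close> independent vectors. Hence \<open>v0 \<le> 2 ((n - 1) + (f0 - 1))\<close>.
\<close>

subsection \<open>Vectors supported on edges\<close>

text \<open>By Borsuk's theorem a branch exists on a compact set exactly if \<open>w\<close> and
  \<open>w'\<close>, both off the set, lie in the same component of its complement. Points of outer
  faces lie outside every curve, so each single curve carries a branch; \<open>x\<close> measures
  how far these branches are from fitting together on the union. Shifting branches by constants
  changes \<open>x\<close> only through differences of the constants, and routing all pairs of faces
  through one fixed face makes that face's own vector zero: these two normalisations are the two
  terms \<open>- 1\<close>, hence the \<open>- 4\<close>. The delicate point is a vector supported
  at two vertices. The walk between the two faces runs through the inside of the cut curve
  \<open>b\<close>, where it may meet other curves. Their parts inside \<open>b\<close> carry no
  outer vertex and are discarded. What is left of each other curve is connected, since two curves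
  cross at most twice, so a single constant matches its branch with one on the whole remaining set.
  If both faces coincide, the branches are constants in 2 pi Z and the needed separation comes from
  Janiszewski's theorem.\<close>

lemma sum_fun_apply: "(\<Sum>x\<in>A. f x) y = (\<Sum>x\<in>A. f x y :: 'a::comm_monoid_add)"
  by (induction A rule: infinite_finite_induct) auto

text \<open>Ore's bound: in a graph without isolated vertices the complement of a minimum dominating
  set dominates as well, so it cannot be smaller.\<close>

lemma dominating_set_half:
  assumes "finite V" and nbr: "\<And>v. v \<in> V \<Longrightarrow> \<exists>u\<in>V. u \<noteq> v \<and> R v u" and sym: "\<And>u v. R u v \<Longrightarrow> R v u"
  obtains T where "T \<subseteq> V" "2 * card T \<le> card V" "\<And>v. v \<in> V - T \<Longrightarrow> \<exists>t\<in>T. R v t"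
proof -
  define dom where "dom T \<longleftrightarrow> T \<subseteq> V \<and> (\<forall>v\<in>V - T. \<exists>t\<in>T. R v t)" for T
  have "dom V" by (auto simp: dom_def)
  then obtain T where T: "dom T" and min: "\<And>T'. dom T' \<Longrightarrow> card T \<le> card T'"
    using ex_has_least_nat[of dom V card] by blast
  have "dom (V - T)"
  proof -
    have "\<exists>u\<in>V - T. R t u" if t: "t \<in> T" for t
    proof (rule ccontr)
      assume none: "\<not> ?thesis"
      have "dom (T - {t})"
        unfolding dom_def
      proof (intro conjI ballI)
        fix v assume v: "v \<in> V - (T - {t})"
        show "\<exists>s\<in>T - {t}. R v s"
        proof (cases "v = t")
          case True
          then show ?thesis
            using nbr[of t] t T none by (auto simp: dom_def)
        next
          case False
          then show ?thesis
            using v T none sym by (fastforce simp: dom_def)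
        qed
      qed (use T in \<open>auto simp: dom_def\<close>)
      moreover have "card (T - {t}) < card T"
        using T t \<open>finite V\<close> by (meson card_Diff1_less dom_def finite_subset)
      ultimately show False
        using min by fastforce
    qed
    then show ?thesis by (auto simp: dom_def)
  qed
  then have "card T \<le> card (V - T)" by (rule min)
  moreover have "card (V - T) = card V - card T" "card T \<le> card V"
    using T \<open>finite V\<close> by (auto simp: dom_def card_Diff_subset finite_subset card_mono)
  ultimately have "2 * card T \<le> card V" by linarith
  then show thesis
    using T that by (auto simp: dom_def)
qed

text \<open>Each \<open>v\<close> gives a combination of the \<open>\<phi> k\<close> supported on an edge \<open>{v, v'}\<close>; edges from the complement
  of a dominating set \<open>T\<close> into \<open>T\<close> give independent vectors.\<close>

lemma card_le_twice_generators:
  fixes \<phi> :: "'k \<Rightarrow> 'v \<Rightarrow> real"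
  assumes "finite V" "finite K"
    and pair: "\<And>v. v \<in> V \<Longrightarrow>
      \<exists>v'\<in>V. v' \<noteq> v \<and> (\<exists>c. \<forall>u\<in>V. (\<Sum>k\<in>K. c k * \<phi> k u) \<noteq> 0 \<longleftrightarrow> u = v \<or> u = v')"
  shows "card V \<le> 2 * card K"
proof -
  interpret vs: vector_space "\<lambda>(r::real) (f :: 'v \<Rightarrow> real) x. r * f x"
    by unfold_locales (auto simp: algebra_simps fun_eq_iff)
  define R where "R v v' \<longleftrightarrow> v \<noteq> v' \<and>
    (\<exists>c. \<forall>u\<in>V. (\<Sum>k\<in>K. c k * \<phi> k u) \<noteq> 0 \<longleftrightarrow> u = v \<or> u = v')" for v v'
  have "R v u \<Longrightarrow> R u v" for u v
    unfolding R_def by metis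
  moreover have "\<exists>u\<in>V. u \<noteq> v \<and> R v u" if "v \<in> V" for v
    using pair[OF that] unfolding R_def by metis
  ultimately obtain T where T: "T \<subseteq> V" "2 * card T \<le> card V" "\<And>v. v \<in> V - T \<Longrightarrow> \<exists>t\<in>T. R v t"
    using dominating_set_half[OF \<open>finite V\<close>, of R] by metis
  have "\<exists>tc. \<forall>v\<in>V - T. fst (tc v) \<in> T \<and>
      (\<forall>u\<in>V. (\<Sum>k\<in>K. snd (tc v) k * \<phi> k u) \<noteq> 0 \<longleftrightarrow> u = v \<or> u = fst (tc v))"
  proof (rule bchoice, rule ballI)
    fix v assume "v \<in> V - T"
    then obtain t where t: "t \<in> T" "R v t" using T(3) by blast
    then obtain c where "\<forall>u\<in>V. (\<Sum>k\<in>K. c k * \<phi> k u) \<noteq> 0 \<longleftrightarrow> u = v \<or> u = t"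
      unfolding R_def by blast
    with t show "\<exists>p. fst p \<in> T \<and> (\<forall>u\<in>V. (\<Sum>k\<in>K. snd p k * \<phi> k u) \<noteq> 0 \<longleftrightarrow> u = v \<or> u = fst p)"
      by (intro exI[of _ "(t, c)"]) auto
  qed
  then obtain tc where tc': "\<forall>v\<in>V - T. fst (tc v) \<in> T \<and>
      (\<forall>u\<in>V. (\<Sum>k\<in>K. snd (tc v) k * \<phi> k u) \<noteq> 0 \<longleftrightarrow> u = v \<or> u = fst (tc v))"
    by blast
  define t c where "t v = fst (tc v)" and "c v = snd (tc v)" for v
  have tc: "v \<in> V - T \<Longrightarrow> t v \<in> T"
      "v \<in> V - T \<Longrightarrow> u \<in> V \<Longrightarrow> (\<Sum>k\<in>K. c v k * \<phi> k u) \<noteq> 0 \<longleftrightarrow> u = v \<or> u = t v" for v u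
    using tc' unfolding t_def c_def by blast+
  define A where "A = V - T"
  define x where "x v = (\<lambda>u. \<Sum>k\<in>K. c v k * \<phi> k u)" for v
  have "finite A" using \<open>finite V\<close> by (simp add: A_def)
  \<comment> \<open>The second end of each edge lies in \<open>T\<close>, so restricted to
    \<open>A\<close> the vectors form a diagonal matrix with nonzero diagonal.\<close>
  have diag: "x v u \<noteq> 0 \<longleftrightarrow> u = v" if "v \<in> A" "u \<in> A" for u v
    using tc(1)[of v] tc(2)[of v u] that by (auto simp: x_def A_def)
  have inj: "inj_on x A"
    by (rule inj_onI) (metis diag)
  have "vs.independent (x ` A)"
  proof (rule vs.independent_if_scalars_zero)
    fix f :: "('v \<Rightarrow> real) \<Rightarrow> real" and y
    assume s: "(\<Sum>z\<in>x ` A. (\<lambda>u. f z * z u)) = 0" and "y \<in> x ` A"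
    then obtain v where v: "v \<in> A" "y = x v" by auto
    have "0 = (\<Sum>z\<in>x ` A. (\<lambda>u. f z * z u)) v"
      by (simp add: s)
    also have "\<dots> = (\<Sum>w\<in>A. f (x w) * x w v)"
      using \<open>finite A\<close>
      by (simp add: sum.reindex[OF inj] sum_fun_apply)
    also have "\<dots> = (\<Sum>w\<in>A. if w = v then f (x v) * x v v else 0)"
      by (intro sum.cong refl) (use diag v in force)
    also have "\<dots> = f (x v) * x v v"
      using \<open>finite A\<close> v by simp
    finally show "f y = 0"
      using diag v by auto
  qed (use \<open>finite A\<close> in auto)
  moreover have "x ` A \<subseteq> vs.span (\<phi> ` K)"
  proof clarify
    fix v
    have "x v = (\<Sum>k\<in>K. (\<lambda>u. c v k * \<phi> k u))"
      using \<open>finite K\<close> by (auto simp: x_def fun_eq_iff sum_fun_apply)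
    moreover have "(\<Sum>k\<in>K. (\<lambda>u. c v k * \<phi> k u)) \<in> vs.span (\<phi> ` K)"
    proof (rule vs.span_sum)
      fix k assume "k \<in> K"
      then show "(\<lambda>u. c v k * \<phi> k u) \<in> vs.span (\<phi> ` K)"
        using vs.span_scale[OF vs.span_base[of "\<phi> k" "\<phi> ` K"], of "c v k"] by simp
    qed
    ultimately show "x v \<in> vs.span (\<phi> ` K)" by simp
  qed
  ultimately have "card (x ` A) \<le> card (\<phi> ` K)"
    using vs.independent_span_bound[of "\<phi> ` K" "x ` A"] \<open>finite K\<close> by blast
  then have "card A \<le> card K"
    using card_image_le[OF \<open>finite K\<close>, of \<phi>] by (simp add: card_image[OF inj])
  moreover have "card A = card V - card T"
    using T \<open>finite V\<close> by (auto simp: A_def card_Diff_subset finite_subset)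
  ultimately show ?thesis
    using T(2) by linarith
qed

text \<open>Serves both normalisations: the base element \<open>z\<close> may be left out of the
  generators because its coefficient or its vector is zero.\<close>

lemma sum_select_nonbase:
  fixes g :: "'a \<Rightarrow> 'b::ring_1"
  assumes "finite S" "a \<in> S" "g z = 0"
  shows "(\<Sum>i\<in>S - {z}. g i * (if a = i then 1 else 0)) = g a"
proof -
  have "(\<Sum>i\<in>S - {z}. g i * (if a = i then 1 else 0)) = (\<Sum>i\<in>S - {z}. if a = i then g i else 0)"
    by (intro sum.cong) auto
  then show ?thesis
    using assms by (auto simp: sum.delta')
qed

subsection \<open>Angle functions\<close>

text \<open>\<open>L\<close> is a continuous branch of \<open>arg (z - w) - arg (z - w')\<close> on \<open>S\<close>; the equation is multiplied out
  to avoid a division.\<close>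

definition angle_fun :: "complex set \<Rightarrow> complex \<Rightarrow> complex \<Rightarrow> (complex \<Rightarrow> real) \<Rightarrow> bool" where
  "angle_fun S w w' L \<longleftrightarrow> continuous_on S L \<and> (\<forall>z\<in>S. sgn (z - w) = cis (L z) * sgn (z - w'))"

text \<open>Borsuk's separation criterion: \<open>w\<close> and \<open>w'\<close> share a component
  iff the radial projections from them onto the circle are homotopic on \<open>S\<close>, that is,
  iff their quotient has a continuous logarithm.\<close>

lemma angle_fun_exists_iff:
  assumes "compact S" "w \<notin> S" "w' \<notin> S"
  shows "(\<exists>L. angle_fun S w w' L) \<longleftrightarrow> connected_component (- S) w w'"
proof -
  have eq: "sgn (z - w) = cis x * sgn (z - w') \<longleftrightarrow>
      (z - w) /\<^sub>R cmod (z - w) / ((z - w') /\<^sub>R cmod (z - w')) = exp (\<i> * of_real x)" if "z \<in> S" for z x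
  proof -
    have "sgn (z - w') \<noteq> 0" using that assms by (auto simp: sgn_zero_iff)
    then show ?thesis
      unfolding cis_conv_exp sgn_div_norm[symmetric] by (simp add: field_simps)
  qed
  have cont: "continuous_on S (\<lambda>z. (z - v) /\<^sub>R cmod (z - v))" if "v \<notin> S" for v
    using that by (intro continuous_intros; force)
  have sph: "(\<lambda>z. (z - v) /\<^sub>R cmod (z - v)) \<in> S \<rightarrow> sphere 0 1" if "v \<notin> S" for v
    using that by (auto simp: divide_simps)
  show ?thesis
    using assms
    apply (simp add: Borsuk_maps_homotopic_in_connected_component_eq [symmetric])
    apply (subst homotopic_circlemaps_divide)
    using cont sph apply (auto simp: inessential_eq_continuous_logarithm_circle angle_fun_def eq)
    done
qed

lemma angle_fun_subset: "angle_fun S w w' L \<Longrightarrow> T \<subseteq> S \<Longrightarrow> angle_fun T w w' L"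
  by (auto simp: angle_fun_def intro: continuous_on_subset)

text \<open>The cocycle rule: branches add along a chain of points, which later routes every pair of
  faces through one base face.\<close>

lemma angle_fun_trans:
  assumes "angle_fun S a b L" "angle_fun S b c M"
  shows "angle_fun S a c (\<lambda>z. L z + M z)"
  unfolding angle_fun_def
proof
  show "continuous_on S (\<lambda>z. L z + M z)"
    using assms by (auto simp: angle_fun_def intro: continuous_on_add)
  show "\<forall>z\<in>S. sgn (z - a) = cis (L z + M z) * sgn (z - c)"
    using assms by (simp add: angle_fun_def flip: cis_mult)
qed

lemma angle_fun_sym:
  assumes "angle_fun S a b L"
  shows "angle_fun S b a (\<lambda>z. - L z)"
  unfolding angle_fun_def
proof
  show "continuous_on S (\<lambda>z. - L z)"
    using assms by (auto simp: angle_fun_def intro: continuous_on_minus)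
  show "\<forall>z\<in>S. sgn (z - b) = cis (- L z) * sgn (z - a)"
    using assms by (simp add: angle_fun_def cis_mult flip: mult.assoc)
qed

lemma angle_fun_refl: "cis k = 1 \<Longrightarrow> angle_fun S w w (\<lambda>_. k)"
  by (simp add: angle_fun_def)

lemma angle_fun_add_period: "angle_fun S a b L \<Longrightarrow> cis k = 1 \<Longrightarrow> angle_fun S a b (\<lambda>z. L z + k)"
  using angle_fun_trans[OF _ angle_fun_refl] by blast

text \<open>Two branches differ by a continuous function with values in 2 pi Z, which is constant on
  a connected set. The domains may differ, so a branch on one curve can be compared with one on a
  larger set.\<close>

lemma angle_fun_unique:
  assumes L: "angle_fun S w w' L" and M: "angle_fun S' w w' M"
    and T: "connected T" "T \<subseteq> S" "T \<subseteq> S'" "w' \<notin> T"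
  obtains k where "cis k = 1" "\<And>z. z \<in> T \<Longrightarrow> L z = M z + k"
proof -
  have one: "cis (L z - M z) = 1" if "z \<in> T" for z
  proof -
    have "cis (L z) * sgn (z - w') = cis (M z) * sgn (z - w')"
      using bspec[OF conjunct2[OF L[unfolded angle_fun_def]], of z]
        bspec[OF conjunct2[OF M[unfolded angle_fun_def]], of z] subsetD[OF T(2) that] subsetD[OF T(3) that]
      by metis
    moreover have "sgn (z - w') \<noteq> 0" using that T by (auto simp: sgn_zero_iff)
    ultimately show ?thesis by (simp flip: cis_divide)
  qed
  have "(\<lambda>z. L z - M z) constant_on T"
  proof (rule continuous_discrete_range_constant[OF \<open>connected T\<close>])
    show "continuous_on T (\<lambda>z. L z - M z)"
      using L M T by (intro continuous_on_diff) (auto simp: angle_fun_def intro: continuous_on_subset)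
    fix x assume x: "x \<in> T"
    \<comment> \<open>Distinct multiples of 2 pi are at least 2 pi apart, so the range of the
      difference is discrete.\<close>
    have "2 * pi \<le> norm ((L y - M y) - (L x - M x))"
      if y: "y \<in> T" and "L y - M y \<noteq> L x - M x" for y
    proof -
      obtain m n where mn: "L y - M y = of_int m * (2 * pi)" "L x - M x = of_int n * (2 * pi)"
        using one[OF x] one[OF y] by (metis cis.simps(1) cos_one_2pi_int one_complex.simps(1) mult.assoc)
      then have "m \<noteq> n" using that by auto
      then have "1 \<le> \<bar>of_int m - of_int n :: real\<bar>" by linarith
      then have "2 * pi \<le> \<bar>of_int m - of_int n :: real\<bar> * \<bar>2 * pi\<bar>" by simp
      then show ?thesis
        unfolding mn real_norm_def by (simp only: left_diff_distrib[symmetric] abs_mult)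
    qed
    then show "\<exists>e>0. \<forall>y. y \<in> T \<and> L y - M y \<noteq> L x - M x \<longrightarrow> e \<le> norm (L y - M y - (L x - M x))"
      by (intro exI[of _ "2 * pi"]) auto
  qed
  then obtain k where k: "\<And>z. z \<in> T \<Longrightarrow> L z - M z = k"
    by (auto simp: constant_on_def)
  show thesis
  proof (cases "T = {}")
    case True
    then show thesis using that[of 0] by simp
  next
    case False
    then have "cis k = 1" using one k by (metis ex_in_conv)
    with k show thesis by (intro that[of k]) (auto simp: algebra_simps)
  qed
qed

lemma angle_fun_glue:
  assumes "closed S" "closed T" "angle_fun S w w' L" "angle_fun T w w' M"
    and "\<And>z. z \<in> S \<inter> T \<Longrightarrow> L z = M z"
  shows "angle_fun (S \<union> T) w w' (\<lambda>z. if z \<in> S then L z else M z)"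
  using assms unfolding angle_fun_def
  by (auto intro!: continuous_on_cases_local simp: closed_subset)

section \<open>Basic facts on Jordan curves\<close>

lemma pseudocircle_Jordan:
  assumes "pseudocircle \<gamma>"
  shows "compact \<gamma>" "connected \<gamma>" "\<gamma> \<noteq> {}" "infinite \<gamma>"
    "open (inside \<gamma>)" "connected (inside \<gamma>)" "inside \<gamma> \<noteq> {}" "frontier (inside \<gamma>) = \<gamma>"
    "open (outside \<gamma>)" "connected (outside \<gamma>)" "outside \<gamma> \<noteq> {}" "frontier (outside \<gamma>) = \<gamma>"
proof -
  obtain g where g: "simple_path g" "pathfinish g = pathstart g" and \<gamma>: "\<gamma> = path_image g"
    using assms by (auto simp: pseudocircle_def)
  show "compact \<gamma>" "connected \<gamma>" "\<gamma> \<noteq> {}"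
    using g unfolding \<gamma> by (simp_all add: compact_simple_path_image connected_simple_path_image)
  show "infinite \<gamma>"
  proof
    assume "finite \<gamma>"
    then have "finite (g ` {0<..<1})"
      by (rule finite_subset[rotated]) (auto simp: \<gamma> path_image_def)
    moreover have "inj_on g {0<..<1}"
      using g by (auto simp: inj_on_def simple_path_def loop_free_def) (metis atLeastAtMost_iff less_irrefl less_le)
    ultimately show False
      using finite_imageD infinite_Ioo[of "0::real" 1] by fastforce
  qed
qed (use assms in \<open>auto simp: pseudocircle_def Jordan_inside_outside\<close>)

lemma Compl_pseudocircle:
  "- \<gamma> = inside \<gamma> \<union> outside \<gamma>" "inside \<gamma> \<inter> outside \<gamma> = {}" "inside \<gamma> \<inter> \<gamma> = {}" "outside \<gamma> \<inter> \<gamma> = {}"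
  using inside_Un_outside[of \<gamma>] inside_Int_outside[of \<gamma>] by auto

subsection \<open>Loops and crossings\<close>

lemma Int_empty_mono: "A \<subseteq> B \<Longrightarrow> B \<inter> C = {} \<Longrightarrow> A \<inter> C = {}"
  by blast

definition loop_onto :: "(real \<Rightarrow> complex) \<Rightarrow> complex set \<Rightarrow> bool" where
  "loop_onto h b \<longleftrightarrow> simple_path h \<and> pathfinish h = pathstart h \<and> path_image h = b"

lemma loop_ontoD:
  assumes "loop_onto h b"
  shows "continuous_on {0..1} h" "h ` {0..1} = b" "h 1 = h 0"
  using assms by (auto simp: loop_onto_def simple_path_def path_def path_image_def pathstart_def pathfinish_def)

lemma loop_onto_inj:
  assumes "loop_onto h b" "h s = h t" "0 < t" "t < 1" "0 \<le> s" "s \<le> 1"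
  shows "s = t"
proof -
  have "loop_free h" using assms(1) by (simp add: loop_onto_def simple_path_def)
  then have "s = t \<or> s = 0 \<and> t = 1 \<or> s = 1 \<and> t = 0"
    using assms(2-) unfolding loop_free_def by (meson atLeastAtMost_iff less_imp_le)
  then show ?thesis using assms by auto
qed

text \<open>Continuity of the inverse of \<open>h\<close> at \<open>h t\<close>: the parameters far
  from \<open>t\<close> have a compact image that misses \<open>h t\<close>.\<close>

lemma loop_onto_near:
  assumes h: "loop_onto h b" and t: "0 < t" "t < 1" and "e > 0"
  obtains d where "d > 0" "\<And>z. z \<in> b \<Longrightarrow> dist (h t) z < d \<Longrightarrow> \<exists>s\<in>{0..1}. \<bar>s - t\<bar> < e \<and> h s = z"
proof -
  let ?K = "{0..1} - ball t e"
  have "compact (h ` ?K)"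
    by (intro compact_continuous_image compact_diff) (auto intro: continuous_on_subset[OF loop_ontoD(1)[OF h]])
  moreover have "h t \<notin> h ` ?K"
  proof
    assume "h t \<in> h ` ?K"
    then obtain s where s: "s \<in> {0..1}" "s \<notin> ball t e" "h s = h t" by force
    then have "s = t" using loop_onto_inj[OF h, of s t] t by auto
    with s \<open>e > 0\<close> show False by simp
  qed
  ultimately obtain d where "d > 0" and d: "\<And>z. z \<in> h ` ?K \<Longrightarrow> d \<le> dist (h t) z"
    using separate_point_closed[of "h ` ?K" "h t"] by (auto simp: compact_imp_closed)
  show thesis
  proof (rule that[OF \<open>d > 0\<close>])
    fix z assume "z \<in> b" "dist (h t) z < d"
    then obtain s where s: "s \<in> {0..1}" "h s = z" using loop_ontoD(2)[OF h] by auto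
    then have "s \<in> ball t e" using d[of z] \<open>dist (h t) z < d\<close> by force
    with s show "\<exists>s\<in>{0..1}. \<bar>s - t\<bar> < e \<and> h s = z"
      by (auto simp: dist_real_def abs_minus_commute)
  qed
qed

lemma loop_onto_leave_finite:
  assumes h: "loop_onto h b" and t: "0 < t" "t < 1" and fin: "finite (b \<inter> c)"
  obtains e where "0 < e" "e \<le> t" "t + e \<le> 1" "\<And>s. \<bar>s - t\<bar> < e \<Longrightarrow> s \<noteq> t \<Longrightarrow> h s \<notin> c"
proof -
  let ?S = "{s \<in> {0<..<1}. h s \<in> c}"
  have "h ` ?S \<subseteq> b \<inter> c" using loop_ontoD(2)[OF h] by auto
  moreover have "inj_on h ?S"
    using loop_onto_inj[OF h] by (auto simp: inj_on_def)
  ultimately have "finite ?S"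
    using fin by (meson finite_imageD finite_subset)
  then obtain d where "d > 0" and d: "\<And>s. s \<in> ?S \<Longrightarrow> s \<noteq> t \<Longrightarrow> d \<le> dist t s"
    using finite_set_avoid[of ?S t] by blast
  show thesis
  proof (rule that[of "min d (min t (1 - t))"])
    fix s assume s: "\<bar>s - t\<bar> < min d (min t (1 - t))" "s \<noteq> t"
    then have "0 < s" "s < 1" "dist t s < d" by (auto simp: dist_real_def abs_if split: if_splits)
    with s d[of s] show "h s \<notin> c" by auto
  qed (use t \<open>d > 0\<close> in auto)
qed

text \<open>Inside and outside are unions of whole components of the complement, distinguished by
  boundedness, so a connected set off \<open>c\<close> cannot meet both.\<close>

lemma connected_avoiding_curve:
  assumes "connected A" "A \<inter> c = {}"
  shows "A \<subseteq> inside c \<or> A \<subseteq> outside c"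
proof (rule ccontr)
  assume "\<not> ?thesis"
  then obtain x y where xy: "x \<in> A" "y \<in> A" "x \<in> inside c" "y \<in> outside c"
    using assms(2) Compl_pseudocircle(1)[of c] by fast
  then have "connected_component (- c) x y"
    using assms unfolding connected_component_def by (intro exI[of _ A]) auto
  then have "connected_component_set (- c) x = connected_component_set (- c) y"
    using connected_component_eq[of y "- c" x] by simp
  then show False
    using xy by (simp add: inside_def outside_def)
qed

lemma two_sides_split:
  assumes "x \<in> P" "y \<in> Q" "P \<inter> Q = {}" "x \<in> A \<union> B" "y \<in> A \<union> B"
    and "A \<subseteq> P \<or> A \<subseteq> Q" "B \<subseteq> P \<or> B \<subseteq> Q"
  shows "A \<subseteq> P \<and> B \<subseteq> Q \<or> A \<subseteq> Q \<and> B \<subseteq> P"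
  using assms by blast

text \<open>\<open>crosses_at\<close> speaks of some parametrisation; this transfers the crossing to
  any given one. Each half of a short arc of \<open>h\<close> around \<open>t\<close> avoids
  \<open>c\<close>, hence lies on one side; the points of the other parametrisation just before and
  after \<open>p\<close> lie on both sides and belong to these halves.\<close>

lemma crosses_at_param:
  assumes c: "pseudocircle c" and fin: "finite (b \<inter> c)" and cr: "crosses_at c b p"
    and h: "loop_onto h b" and t: "0 < t" "t < 1" "h t = p"
  obtains e where "0 < e" "e \<le> t" "t + e \<le> 1"
    "h ` {t-e<..<t} \<subseteq> inside c \<and> h ` {t<..<t+e} \<subseteq> outside c \<or>
     h ` {t-e<..<t} \<subseteq> outside c \<and> h ` {t<..<t+e} \<subseteq> inside c"
proof -
  obtain e where e: "0 < e" "e \<le> t" "t + e \<le> 1" "\<And>s. \<bar>s - t\<bar> < e \<Longrightarrow> s \<noteq> t \<Longrightarrow> h s \<notin> c"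
    using loop_onto_leave_finite[OF h t(1,2) fin] by metis
  have side: "h ` I \<subseteq> inside c \<or> h ` I \<subseteq> outside c" if I: "connected I" "I \<subseteq> {t-e<..<t+e} - {t}" for I
  proof (rule connected_avoiding_curve)
    have "I \<subseteq> {0..1}" using I(2) e by auto
    then show "connected (h ` I)"
      by (intro connected_continuous_image I(1) continuous_on_subset[OF loop_ontoD(1)[OF h]])
    have "h s \<notin> c" if s: "s \<in> I" for s
      using e(4)[of s] subsetD[OF I(2) s] by (auto simp: abs_less_iff)
    then show "h ` I \<inter> c = {}" by auto
  qed
  have L: "h ` {t-e<..<t} \<subseteq> inside c \<or> h ` {t-e<..<t} \<subseteq> outside c"
   and R: "h ` {t<..<t+e} \<subseteq> inside c \<or> h ` {t<..<t+e} \<subseteq> outside c"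
    by (rule side; use e in force)+
  obtain g t' e' where g: "loop_onto g b" and t': "0 < t'" "t' < 1" "g t' = p" "e' > 0"
    and g': "(\<forall>s. t' - e' < s \<and> s < t' \<longrightarrow> g s \<in> inside c) \<and> (\<forall>s. t' < s \<and> s < t' + e' \<longrightarrow> g s \<in> outside c) \<or>
      (\<forall>s. t' - e' < s \<and> s < t' \<longrightarrow> g s \<in> outside c) \<and> (\<forall>s. t' < s \<and> s < t' + e' \<longrightarrow> g s \<in> inside c)"
    using cr unfolding crosses_at_def loop_onto_def by blast
  obtain d where d: "d > 0" "\<And>z. z \<in> b \<Longrightarrow> dist p z < d \<Longrightarrow> \<exists>s\<in>{0..1}. \<bar>s - t\<bar> < e \<and> h s = z"
    using loop_onto_near[OF h t(1,2) e(1)] t(3) by metis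
  have "continuous_on {0..1} g" by (rule loop_ontoD[OF g])
  moreover have "t' \<in> {0..1}" using t' by simp
  ultimately obtain r where r: "r > 0" "\<And>s. s \<in> {0..1} \<Longrightarrow> dist s t' < r \<Longrightarrow> dist (g s) p < d"
    using t'(3) d(1) unfolding continuous_on_iff by blast
  \<comment> \<open>Small enough that \<open>t' - \<delta>\<close> and \<open>t' + \<delta>\<close>
    are valid parameters within the crossing window of \<open>g\<close> and that their images fall
    into the window of \<open>h\<close>.\<close>
  define \<delta> where "\<delta> = min (min r e') (min t' (1 - t')) / 2"
  have \<delta>: "0 < \<delta>" "\<delta> < r" "\<delta> < e'" "\<delta> < t'" "\<delta> < 1 - t'"
    using r t' by (auto simp: \<delta>_def min_def)
  have near: "g s \<in> h ` {t-e<..<t} \<union> h ` {t<..<t+e}" if "s = t' - \<delta> \<or> s = t' + \<delta>" for s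
  proof -
    have s: "s \<in> {0..1}" "dist s t' < r" "s \<noteq> t'" using that \<delta> by (auto simp: dist_real_def)
    then have "g s \<in> b" "dist p (g s) < d"
      using loop_ontoD(2)[OF g] r by (auto simp: dist_commute)
    then obtain s' where s': "s' \<in> {0..1}" "\<bar>s' - t\<bar> < e" "h s' = g s" using d by blast
    have "g s \<noteq> g t'" using loop_onto_inj[OF g _ t'(1,2), of s] s by auto
    then have "s' \<noteq> t" using t t' s' by auto
    then have "s' \<in> {t-e<..<t} \<union> {t<..<t+e}" using s'(2) by (auto simp: abs_less_iff)
    with s'(3) show ?thesis by (metis imageI image_Un)
  qed
  \<comment> \<open>An unordered pair, since \<open>g\<close> may run through \<open>b\<close> in
    the opposite direction to \<open>h\<close>.\<close>
  have "\<exists>x\<in>inside c. \<exists>y\<in>outside c. {x, y} = {g (t' - \<delta>), g (t' + \<delta>)}"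
  proof -
    have "g (t' - \<delta>) \<in> inside c \<and> g (t' + \<delta>) \<in> outside c \<or> g (t' - \<delta>) \<in> outside c \<and> g (t' + \<delta>) \<in> inside c"
      using g' \<delta> by auto
    then show ?thesis by (metis insert_commute)
  qed
  then obtain x y where x: "x \<in> inside c" and y: "y \<in> outside c"
    and xy: "{x, y} = {g (t' - \<delta>), g (t' + \<delta>)}"
    by blast
  have xy': "{x, y} \<subseteq> h ` {t-e<..<t} \<union> h ` {t<..<t+e}"
    unfolding xy using near[of "t' - \<delta>"] near[of "t' + \<delta>"] by simp
  have "h ` {t-e<..<t} \<subseteq> inside c \<and> h ` {t<..<t+e} \<subseteq> outside c \<or>
     h ` {t-e<..<t} \<subseteq> outside c \<and> h ` {t<..<t+e} \<subseteq> inside c"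
    by (rule two_sides_split[OF x y Compl_pseudocircle(2) subsetD[OF xy' insertI1]
          subsetD[OF xy' insertI2[OF insertI1]] L R])
  with e(1-3) show thesis by (rule that)
qed

text \<open>If \<open>x\<close> is the base point, shifting the base point by 1/2 makes it an
  interior point of the parametrisation.\<close>

lemma loop_onto_through:
  assumes "pseudocircle b" "x \<in> b"
  obtains h t where "loop_onto h b" "0 < t" "t < 1" "h t = x"
proof -
  obtain g where g: "loop_onto g b"
    using assms by (auto simp: pseudocircle_def loop_onto_def)
  then obtain s where s: "0 \<le> s" "s \<le> 1" "g s = x"
    using assms(2) loop_ontoD(2)[OF g] by auto
  show thesis
  proof (cases "s = 0 \<or> s = 1")
    case True
    have "loop_onto (shiftpath (1/2) g) b"
      using g by (auto simp: loop_onto_def simple_path_shiftpath closed_shiftpath path_image_shiftpath)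
    moreover have "shiftpath (1/2) g (1/2) = x"
      using True s loop_ontoD(3)[OF g] by (auto simp: shiftpath_def)
    ultimately show thesis using that[of "shiftpath (1/2) g" "1/2"] by simp
  next
    case False
    then show thesis using that[of g s] g s by auto
  qed
qed

lemma loop_onto_minus_arc_connected:
  assumes h: "loop_onto h b" and t: "0 < e" "e \<le> t" "t + e \<le> 1"
  shows "connected (h ` ({0..1} - {t-e<..<t+e}))"
proof -
  have "{0..1} - {t-e<..<t+e} = {0..t-e} \<union> {t+e..1}" using t by auto
  moreover have "connected (h ` {0..t-e})" "connected (h ` {t+e..1})"
    using t by (auto intro!: connected_continuous_image continuous_on_subset[OF loop_ontoD(1)[OF h]])
  moreover have "h 0 \<in> h ` {0..t-e}" "h 0 \<in> h ` {t+e..1}"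
    using t loop_ontoD(3)[OF h] by (auto intro: image_eqI[of _ _ 1])
  ultimately show ?thesis
    by (simp only: image_Un) (intro connected_Un, auto)
qed

subsection \<open>Outer faces\<close>

locale pseudocircle_arrangement =
  fixes \<Gamma> :: "complex set set"
  assumes arr: "arrangement \<Gamma>"
begin

lemma finite_curves: "finite \<Gamma>"
  using arr by (simp add: arrangement_def)

lemma pseudocircle: "i \<in> \<Gamma> \<Longrightarrow> pseudocircle i"
  using arr by (simp add: arrangement_def)

lemma no_triple:
  assumes "a \<in> \<Gamma>" "b \<in> \<Gamma>" "c \<in> \<Gamma>" "x \<in> a" "x \<in> b" "x \<in> c"
  shows "a = b \<or> a = c \<or> b = c"
proof (rule ccontr)
  assume "\<not> ?thesis"
  then have "a \<inter> b \<inter> c = {}" using arr assms(1-3) unfolding arrangement_def by metis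
  with assms show False by blast
qed

lemma finite_Int: "a \<in> \<Gamma> \<Longrightarrow> b \<in> \<Gamma> \<Longrightarrow> a \<noteq> b \<Longrightarrow> finite (a \<inter> b)"
  and card_Int: "a \<in> \<Gamma> \<Longrightarrow> b \<in> \<Gamma> \<Longrightarrow> a \<noteq> b \<Longrightarrow> card (a \<inter> b) \<le> 2"
  using arr by (simp_all add: arrangement_def)

lemma crosses: "a \<in> \<Gamma> \<Longrightarrow> b \<in> \<Gamma> \<Longrightarrow> a \<noteq> b \<Longrightarrow> p \<in> a \<Longrightarrow> p \<in> b \<Longrightarrow> crosses_at a b p"
  using arr by (simp add: arrangement_def)

text \<open>With closed discs the set is closed and contains every outer vertex on \<open>b\<close>;
  leaving out \<open>b\<close> itself makes it a condition on points of \<open>b\<close>.\<close>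

definition covered :: "complex set \<Rightarrow> complex set" where
  "covered b = (\<Union>i\<in>\<Gamma>-{b}. i \<union> inside i)"

definition outer_vertices :: "complex set" where
  "outer_vertices = {v \<in> vertices \<Gamma>. \<forall>i\<in>\<Gamma>. v \<notin> inside i}"

definition outer_faces :: "complex set set" where
  "outer_faces = {F \<in> components (- \<Union>\<Gamma>). \<forall>i\<in>\<Gamma>. F \<subseteq> outside i}"

lemma notin_covered_iff: "x \<notin> covered b \<longleftrightarrow> (\<forall>i\<in>\<Gamma>-{b}. x \<in> outside i)"
  using Compl_pseudocircle unfolding covered_def by blast

lemma closed_covered: "closed (covered b)"
proof -
  have "closed (i \<union> inside i)" if "i \<in> \<Gamma>" for i
    using pseudocircle_Jordan(9)[OF pseudocircle[OF that]]
    by (metis Compl_Un closed_def inside_Un_outside outside_inside union_with_inside)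
  then show ?thesis
    unfolding covered_def using finite_curves by auto
qed

lemma v0_eq: "v0 \<Gamma> = card outer_vertices"
  using finite_curves by (auto simp: v0_def outer_vertices_def point_weight_def intro!: arg_cong[of _ _ card])

lemma f0_eq: "f0 \<Gamma> = card outer_faces"
proof -
  have "face_weight \<Gamma> F = 0 \<longleftrightarrow> (\<forall>i\<in>\<Gamma>. F \<subseteq> outside i)" if F: "F \<in> components (- \<Union>\<Gamma>)" for F
  proof -
    have "F \<subseteq> inside i \<longleftrightarrow> \<not> F \<subseteq> outside i" if "i \<in> \<Gamma>" for i
    proof -
      have "connected F" "F \<inter> i = {}" "F \<noteq> {}"
        using F that in_components_connected in_components_subset in_components_nonempty by blast+
      then show ?thesis
        using connected_avoiding_curve[of F i] Compl_pseudocircle(2)[of i] by blast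
    qed
    then show ?thesis
      using finite_curves by (auto simp: face_weight_def)
  qed
  then show ?thesis
    by (auto simp: f0_def outer_faces_def faces_def intro!: arg_cong[of _ _ card])
qed

lemma finite_vertices: "finite (vertices \<Gamma>)"
proof -
  have "vertices \<Gamma> \<subseteq> (\<Union>a\<in>\<Gamma>. \<Union>b\<in>\<Gamma>-{a}. a \<inter> b)"
    unfolding vertices_def by blast
  then show ?thesis
    by (rule finite_subset) (intro finite_UN_I finite_curves finite_Diff finite_Int; auto)
qed

lemma finite_outer_vertices: "finite outer_vertices"
  using finite_vertices by (simp add: outer_vertices_def)

lemma outer_vertex_other_curve:
  assumes "u \<in> outer_vertices" "b \<in> \<Gamma>" "u \<in> b"
  obtains c where "c \<in> \<Gamma>" "c \<noteq> b" "u \<in> c" "\<And>i. i \<in> \<Gamma> \<Longrightarrow> u \<in> i \<Longrightarrow> i = b \<or> i = c"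
proof -
  obtain a a' where "a \<in> \<Gamma>" "a' \<in> \<Gamma>" "a \<noteq> a'" "u \<in> a" "u \<in> a'"
    using assms(1) by (auto simp: outer_vertices_def vertices_def)
  then show thesis
    using that no_triple assms(2,3) by metis
qed

text \<open>By Janiszewski's theorem, applied to \<open>b\<close> and the union of the other curves with \<open>b\<close> minus a small arc
  around \<open>x\<close>; these two sets meet in an arc.\<close>

lemma outer_face_near:
  assumes b: "b \<in> \<Gamma>" and x: "x \<in> b" "x \<notin> covered b"
  obtains F e where "F \<in> outer_faces" "e > 0" "ball x e \<inter> outside b \<subseteq> F"
proof -
  obtain h t where h: "loop_onto h b" and t: "0 < t" "t < 1" "h t = x"
    using loop_onto_through[OF pseudocircle[OF b] x(1)] by metis
  obtain d where d: "d > 0" "ball x d \<inter> covered b = {}"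
    using closed_covered x(2) by (metis Compl_iff disjoint_eq_subset_Compl open_Compl open_contains_ball_eq)
  have "t \<in> {0..1}" using t by simp
  then obtain e0 where e0: "e0 > 0" "\<And>s. s \<in> {0..1} \<Longrightarrow> dist s t < e0 \<Longrightarrow> dist (h s) x < d"
    using loop_ontoD(1)[OF h] d(1) t(3) unfolding continuous_on_iff by blast
  \<comment> \<open>The arc over \<open>{t-e<..<t+e}\<close> stays uncovered, so the other curves
    meet \<open>b\<close> only in its complement \<open>\<beta>\<close>.\<close>
  define e where "e = min e0 (min t (1 - t))"
  have e: "0 < e" "e \<le> t" "t + e \<le> 1" using e0 t by (auto simp: e_def)
  define \<beta> where "\<beta> = h ` ({0..1} - {t-e<..<t+e})"
  have "h s \<notin> covered b" if "s \<in> {t-e<..<t+e}" for s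
  proof -
    have "s \<in> {0..1}" "dist s t < e0" using that e by (auto simp: e_def dist_real_def)
    then have "h s \<in> ball x d" using e0 by (auto simp: dist_commute)
    then show ?thesis using d by auto
  qed
  then have "b \<inter> covered b \<subseteq> \<beta>"
    using loop_ontoD(2)[OF h] by (auto simp: \<beta>_def)
  then have int: "b \<inter> (\<Union>(\<Gamma> - {b}) \<union> \<beta>) = \<beta>"
    using loop_ontoD(2)[OF h] by (auto simp: covered_def \<beta>_def)
  have "compact \<beta>"
    unfolding \<beta>_def
    by (intro compact_continuous_image compact_diff) (auto intro: continuous_on_subset[OF loop_ontoD(1)[OF h]])
  then have clo: "closed (\<Union>(\<Gamma> - {b}) \<union> \<beta>)"
    using finite_curves pseudocircle_Jordan(1)[OF pseudocircle] by (auto intro!: closed_Un closed_Union compact_imp_closed)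
  have "x \<notin> \<beta>"
  proof
    assume "x \<in> \<beta>"
    then obtain s where s: "s \<in> {0..1}" "s \<notin> {t-e<..<t+e}" "h s = h t" unfolding \<beta>_def using t(3) by auto
    then have "s = t" using loop_onto_inj[OF h s(3) t(1,2)] by simp
    with s e show False by simp
  qed
  moreover have "x \<notin> \<Union>(\<Gamma> - {b})"
    using x(2) by (auto simp: covered_def)
  ultimately have "x \<in> - (\<Union>(\<Gamma> - {b}) \<union> \<beta>)" by simp
  then obtain r0 where r0: "r0 > 0" "ball x r0 \<subseteq> - (\<Union>(\<Gamma> - {b}) \<union> \<beta>)"
    using clo openE[of "- (\<Union>(\<Gamma> - {b}) \<union> \<beta>)" x] by (metis open_Compl)
  define r where "r = min r0 d"
  have r: "r > 0" "ball x r \<subseteq> - (\<Union>(\<Gamma> - {b}) \<union> \<beta>)" "ball x r \<inter> covered b = {}"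
    using r0 d by (auto simp: r_def)
  have conn: "connected_component (- \<Union>\<Gamma>) y y'" if "y \<in> ball x r \<inter> outside b" "y' \<in> ball x r \<inter> outside b" for y y'
  proof -
    \<comment> \<open>The two points are joined off \<open>b\<close> through
      \<open>outside b\<close>, and off the second set through the ball.\<close>
    have "connected_component (- (b \<union> (\<Union>(\<Gamma> - {b}) \<union> \<beta>))) y y'"
    proof (rule Janiszewski[OF pseudocircle_Jordan(1)[OF pseudocircle[OF b]] clo])
      show "connected (b \<inter> (\<Union>(\<Gamma> - {b}) \<union> \<beta>))"
        unfolding int unfolding \<beta>_def by (rule loop_onto_minus_arc_connected[OF h e])
      show "connected_component (- b) y y'"
        unfolding connected_component_def
        using that pseudocircle_Jordan(10)[OF pseudocircle[OF b]] Compl_pseudocircle(4)[of b]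
        by blast
      show "connected_component (- (\<Union>(\<Gamma> - {b}) \<union> \<beta>)) y y'"
        unfolding connected_component_def using that r(2)
        by (intro exI[of _ "ball x r"]) auto
    qed
    then show ?thesis
      by (rule connected_component_of_subset) auto
  qed
  have "x \<in> closure (outside b)"
    using pseudocircle_Jordan(12)[OF pseudocircle[OF b]] x(1) by (auto simp: frontier_def)
  then obtain y where y: "y \<in> ball x r \<inter> outside b"
    using r(1) unfolding closure_approachable by (metis IntI dist_commute mem_ball)
  let ?F = "connected_component_set (- \<Union>\<Gamma>) y"
  have "y \<in> - \<Union>\<Gamma>" using conn[OF y y] connected_component_in by blast
  then have F: "?F \<in> components (- \<Union>\<Gamma>)" "y \<in> ?F" by (auto simp: componentsI)
  have "?F \<subseteq> outside i" if "i \<in> \<Gamma>" for i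
  proof -
    have "y \<in> outside i"
      using y r(3) notin_covered_iff that by (cases "i = b") blast+
    moreover have "?F \<inter> i = {}"
      using connected_component_subset that by blast
    ultimately show ?thesis
      using connected_avoiding_curve[OF connected_connected_component, of "- \<Union>\<Gamma>" y i]
        F(2) Compl_pseudocircle(2)[of i] by blast
  qed
  then have "?F \<in> outer_faces" using F by (auto simp: outer_faces_def)
  then show thesis
    using that[OF _ r(1), of ?F] conn[OF y] by blast
qed

text \<open>Uniqueness holds because every outer face lies in \<open>outside b\<close>, whose points
  near \<open>x\<close> all belong to one face.\<close>

lemma outer_face_at:
  assumes b: "b \<in> \<Gamma>" and x: "x \<in> b" "x \<notin> covered b"
  obtains F where "F \<in> outer_faces" "x \<in> closure F" "\<And>G. G \<in> outer_faces \<Longrightarrow> x \<in> closure G \<Longrightarrow> G = F"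
    "\<exists>e>0. \<forall>x'\<in>b. dist x x' < e \<longrightarrow> x' \<in> closure F"
proof -
  obtain F e where F: "F \<in> outer_faces" "e > 0" "ball x e \<inter> outside b \<subseteq> F"
    using outer_face_near[OF assms] by metis
  have near: "x' \<in> closure F" if "x' \<in> b" "dist x x' < e" for x'
  proof -
    have "x' \<in> closure (outside b)"
      using pseudocircle_Jordan(12)[OF pseudocircle[OF b]] that by (auto simp: frontier_def)
    then have "x' \<in> closure (ball x e \<inter> outside b)"
      using that(2) open_Int_closure_subset[of "ball x e" "outside b"] by auto
    then show ?thesis using closure_mono[OF F(3)] by blast
  qed
  show thesis
  proof (rule that[OF F(1)])
    show "x \<in> closure F" using near x F by simp
    show "\<exists>e>0. \<forall>x'\<in>b. dist x x' < e \<longrightarrow> x' \<in> closure F" using near F by blast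
    fix G assume G: "G \<in> outer_faces" "x \<in> closure G"
    then obtain z where "z \<in> G" "z \<in> ball x e"
      using F(2) unfolding closure_approachable by (metis dist_commute mem_ball)
    moreover have "z \<in> outside b" using \<open>z \<in> G\<close> G b unfolding outer_faces_def by blast
    ultimately have "z \<in> F" using F(3) by blast
    moreover have "F \<in> components (- \<Union>\<Gamma>)" "G \<in> components (- \<Union>\<Gamma>)"
      using F(1) G(1) by (auto simp: outer_faces_def)
    ultimately show "G = F"
      using components_nonoverlap \<open>z \<in> G\<close> by blast
  qed
qed

text \<open>A clopen argument: at a point of the arc adherent to \<open>F\<close>, the unique outer
  face there is \<open>F\<close>, and it is adherent to all nearby points of
  \<open>b\<close>.\<close>

lemma outer_face_along_arc:
  assumes b: "b \<in> \<Gamma>" and A: "connected A" "A \<subseteq> b - covered b"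
    and F: "F \<in> outer_faces" "x \<in> A" "x \<in> closure F" and x': "x' \<in> A"
  shows "x' \<in> closure F"
proof -
  have "openin (top_of_set A) (A \<inter> closure F)"
    unfolding openin_contains_ball
  proof (intro conjI ballI)
    fix z assume z: "z \<in> A \<inter> closure F"
    then have zb: "z \<in> b" "z \<notin> covered b" using A by auto
    obtain G where G: "\<And>G'. G' \<in> outer_faces \<Longrightarrow> z \<in> closure G' \<Longrightarrow> G' = G"
      "\<exists>e>0. \<forall>x'\<in>b. dist z x' < e \<longrightarrow> x' \<in> closure G"
      using outer_face_at[OF b zb] by metis
    have "F = G" using G(1) F z by blast
    with G(2) obtain e where "e > 0" "\<And>x'. x' \<in> b \<Longrightarrow> dist z x' < e \<Longrightarrow> x' \<in> closure F" by metis
    then show "\<exists>e>0. ball z e \<inter> A \<subseteq> A \<inter> closure F"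
      using A(2) by (intro exI[of _ e]) auto
  qed auto
  moreover have "closedin (top_of_set A) (A \<inter> closure F)"
    by (simp add: closedin_closed_Int)
  ultimately have "A \<inter> closure F = {} \<or> A \<inter> closure F = A"
    using A(1) by (simp add: connected_clopen)
  then show ?thesis using F x' by blast
qed

lemma disjoint_coveredI:
  assumes "\<And>i. i \<in> \<Gamma> - {b} \<Longrightarrow> A \<subseteq> outside i"
  shows "A \<inter> covered b = {}"
  using assms notin_covered_iff[of _ b] unfolding disjoint_iff by (meson subsetD)

text \<open>Removing finitely many points leaves the plane connected, so the frontier of
  \<open>F\<close> cannot consist of such points alone; a remaining frontier point is on a curve
  and, not being a vertex, lies outside all others.\<close>

lemma outer_face_touches_edge:
  assumes ne: "\<Gamma> \<noteq> {}" and H: "\<And>b. b \<in> \<Gamma> \<Longrightarrow> loop_onto (H b) b" and F: "F \<in> outer_faces"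
  obtains b s where "b \<in> \<Gamma>" "0 < s" "s < 1" "H b s \<notin> vertices \<Gamma>" "H b s \<in> closure F" "H b s \<notin> covered b"
proof -
  \<comment> \<open>Base points are excluded too, which forces the parameter \<open>s\<close> to be
    interior.\<close>
  let ?N = "vertices \<Gamma> \<union> (\<lambda>b. H b 0) ` \<Gamma>"
  have finN: "finite ?N" using finite_vertices finite_curves by simp
  have clo: "closed (\<Union>\<Gamma>)"
    using finite_curves pseudocircle_Jordan(1)[OF pseudocircle] compact_imp_closed by blast
  have Fc: "F \<in> components (- \<Union>\<Gamma>)" using F by (simp add: outer_faces_def)
  then have "open F" "F \<noteq> {}" "F \<inter> \<Union>\<Gamma> = {}"
    using open_components[of "- \<Union>\<Gamma>" F] clo in_components_nonempty in_components_subset by blast+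
  then have "infinite F" using finite_imp_not_open by blast
  then have 1: "- ?N \<inter> F \<noteq> {}" using finN finite_subset[of F ?N] by blast
  obtain b0 where "b0 \<in> \<Gamma>" using ne by blast
  then have "infinite b0" using pseudocircle_Jordan(4)[OF pseudocircle] by blast
  then have "\<not> b0 \<subseteq> ?N" using finN finite_subset by blast
  then have 2: "- ?N - F \<noteq> {}" using \<open>F \<inter> \<Union>\<Gamma> = {}\<close> \<open>b0 \<in> \<Gamma>\<close> by blast
  have "connected (- ?N)"
    by (intro path_connected_imp_connected path_connected_complement_countable countable_finite finN) simp
  then obtain x where x: "x \<notin> ?N" "x \<in> frontier F"
    using connected_Int_frontier[OF _ 1 2] by blast
  then obtain b where b: "b \<in> \<Gamma>" "x \<in> b"
    using frontier_of_components_closed_complement[OF clo Fc] by blast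
  have xF: "x \<in> closure F" using x(2) by (simp add: frontier_def)
  have "x \<in> outside i" if i: "i \<in> \<Gamma> - {b}" for i
  proof -
    have "x \<notin> i" using x(1) b i by (auto simp: vertices_def)
    moreover have "x \<in> closure (outside i)"
      using closure_mono[of F "outside i"] xF F i by (auto simp: outer_faces_def)
    moreover have "closure (outside i) \<subseteq> outside i \<union> i"
      using pseudocircle_Jordan(12)[OF pseudocircle, of i] i by (simp add: closure_Un_frontier)
    ultimately show ?thesis by blast
  qed
  then have cov: "x \<notin> covered b" unfolding notin_covered_iff by blast
  obtain s where s: "s \<in> {0..1}" "H b s = x"
    using loop_ontoD(2)[OF H[OF b(1)]] b(2) by (metis imageE)
  have "H b 0 \<in> ?N" using b(1) by blast
  then have "s \<noteq> 0" "s \<noteq> 1" using s x(1) loop_ontoD(3)[OF H[OF b(1)]] by auto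
  with s have "0 < s" "s < 1" by auto
  then show thesis
    using that[OF b(1)] s x(1) xF cov by simp
qed

text \<open>Without a vertex the arc meets no other curve, so it stays uncovered from its start on
  and the same outer face follows it.\<close>

lemma outer_face_along_edge:
  assumes b: "b \<in> \<Gamma>" and h: "loop_onto h b" and st: "0 \<le> s" "s \<le> t" "t \<le> 1"
    and nv: "\<And>r. s \<le> r \<Longrightarrow> r \<le> t \<Longrightarrow> h r \<notin> vertices \<Gamma>"
    and F: "F \<in> outer_faces" "h s \<in> closure F" "h s \<notin> covered b"
    and G: "G \<in> outer_faces" "h t \<in> closure G"
  shows "F = G"
proof -
  let ?A = "h ` {s..t}"
  have con: "connected ?A"
    using st by (auto intro!: connected_continuous_image continuous_on_subset[OF loop_ontoD(1)[OF h]])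
  have "{s..t} \<subseteq> {0..1}" using st by auto
  then have sub: "?A \<subseteq> b" using loop_ontoD(2)[OF h] by blast
  have out: "?A \<subseteq> outside i" if i: "i \<in> \<Gamma> - {b}" for i
  proof -
    have "b \<inter> i \<subseteq> vertices \<Gamma>"
      using b i unfolding vertices_def by blast
    moreover have "?A \<inter> vertices \<Gamma> = {}" using nv by auto
    ultimately have "?A \<inter> i = {}" using sub by blast
    moreover have "h s \<in> ?A" "h s \<in> outside i"
      using st F(3) i unfolding notin_covered_iff by auto
    ultimately show ?thesis
      using connected_avoiding_curve[OF con, of i] Compl_pseudocircle(2)[of i] by blast
  qed
  have "?A \<inter> covered b = {}"
    by (rule disjoint_coveredI[OF out])
  then have A: "?A \<subseteq> b - covered b" using sub by blast
  have tA: "h t \<in> ?A" "h s \<in> ?A" using st by auto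
  have "h t \<in> closure F"
    using outer_face_along_arc[OF b con A F(1) tA(2) F(2) tA(1)] .
  moreover have "h t \<in> b" "h t \<notin> covered b" using A tA by auto
  ultimately obtain F' where "\<And>G. G \<in> outer_faces \<Longrightarrow> h t \<in> closure G \<Longrightarrow> G = F'"
    using outer_face_at[OF b, of "h t"] by metis
  then show "F = G"
    using \<open>h t \<in> closure F\<close> F(1) G by blast
qed

text \<open>Without this, \<open>f0\<close> would be the cardinality of an infinite set, i.e. \<open>0\<close>.\<close>

lemma finite_outer_faces:
  assumes "\<Gamma> \<noteq> {}"
  shows "finite outer_faces"
proof -
  have "\<forall>b\<in>\<Gamma>. \<exists>h. loop_onto h b"
    using pseudocircle by (auto simp: pseudocircle_def loop_onto_def)
  then obtain H where H: "\<And>b. b \<in> \<Gamma> \<Longrightarrow> loop_onto (H b) b" by metis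
  \<comment> \<open>The parameter 0 guarantees that some element of \<open>T b\<close> precedes any
    touching point, so the maximum in \<open>\<kappa>\<close> exists.\<close>
  define T where "T b = {r \<in> {0<..<1}. H b r \<in> vertices \<Gamma>} \<union> {0}" for b
  have finT: "finite (T b)" if "b \<in> \<Gamma>" for b
  proof -
    have "inj_on (H b) {r \<in> {0<..<1}. H b r \<in> vertices \<Gamma>}"
      using loop_onto_inj[OF H[OF that]] by (auto simp: inj_on_def)
    moreover have "finite (H b ` {r \<in> {0<..<1}. H b r \<in> vertices \<Gamma>})"
      by (rule finite_subset[OF _ finite_vertices]) auto
    ultimately show ?thesis
      unfolding T_def using finite_imageD by blast
  qed
  have "\<forall>F\<in>outer_faces. \<exists>p. fst p \<in> \<Gamma> \<and> 0 < snd p \<and> snd p < 1 \<and> H (fst p) (snd p) \<notin> vertices \<Gamma> \<and>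
      H (fst p) (snd p) \<in> closure F \<and> H (fst p) (snd p) \<notin> covered (fst p)"
    using outer_face_touches_edge[OF assms H] by (metis fst_conv snd_conv)
  then obtain p where p: "\<And>F. F \<in> outer_faces \<Longrightarrow> fst (p F) \<in> \<Gamma> \<and> 0 < snd (p F) \<and> snd (p F) < 1 \<and>
      H (fst (p F)) (snd (p F)) \<notin> vertices \<Gamma> \<and>
      H (fst (p F)) (snd (p F)) \<in> closure F \<and> H (fst (p F)) (snd (p F)) \<notin> covered (fst (p F))"
    by metis
  \<comment> \<open>Encodes the edge on which \<open>F\<close> is touched: its curve and the last
    parameter in \<open>T\<close> up to the touching point. Equal codes leave no vertex between two
    touching points.\<close>
  define \<kappa> where "\<kappa> F = (fst (p F), Max {r \<in> T (fst (p F)). r \<le> snd (p F)})" for F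
  have le: "F = G" if FG: "F \<in> outer_faces" "G \<in> outer_faces" "\<kappa> F = \<kappa> G" "snd (p F) \<le> snd (p G)" for F G
  proof -
    define b s t where "b = fst (p F)" and "s = snd (p F)" and "t = snd (p G)"
    have b: "b = fst (p G)" "b \<in> \<Gamma>" using FG p by (auto simp: b_def \<kappa>_def)
    have max: "Max {r \<in> T b. r \<le> s} = Max {r \<in> T b. r \<le> t}"
    proof -
      have "snd (\<kappa> F) = snd (\<kappa> G)" using FG(3) by simp
      then show ?thesis unfolding \<kappa>_def snd_conv b(1)[symmetric] b_def[symmetric] s_def[symmetric] t_def[symmetric] .
    qed
    have 0: "0 \<in> T b" by (simp add: T_def)
    have s: "0 < s" "s < 1" "t < 1" "s \<le> t" "H b s \<notin> vertices \<Gamma>" using FG p[OF FG(1)] p[OF FG(2)] by (auto simp: b_def s_def t_def)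
    have "H b r \<notin> vertices \<Gamma>" if r: "s \<le> r" "r \<le> t" for r
    proof
      assume "H b r \<in> vertices \<Gamma>"
      then have "r \<in> {r \<in> T b. r \<le> t}" using r s by (auto simp: T_def)
      then have "r \<le> Max {r \<in> T b. r \<le> t}"
        using finT[OF b(2)] by (intro Max_ge) auto
      also have "\<dots> \<le> s"
        unfolding max[symmetric] using finT[OF b(2)] 0 s(1) by (subst Max_le_iff) (auto intro: exI[of _ 0])
      finally have "r = s" using r by simp
      with \<open>H b r \<in> vertices \<Gamma>\<close> s show False by simp
    qed
    then show "F = G"
      using outer_face_along_edge[OF b(2) H[OF b(2)], of s t F G] s FG(1,2) p[OF FG(1)] p[OF FG(2)] b
      by (simp add: b_def[symmetric] s_def[symmetric] t_def[symmetric])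
  qed
  have "inj_on \<kappa> outer_faces"
    by (rule inj_onI) (metis le linear)
  moreover have "\<kappa> ` outer_faces \<subseteq> (SIGMA b:\<Gamma>. T b)"
  proof
    fix y assume "y \<in> \<kappa> ` outer_faces"
    then obtain F where F: "F \<in> outer_faces" "y = \<kappa> F" by blast
    have "Max {r \<in> T (fst (p F)). r \<le> snd (p F)} \<in> {r \<in> T (fst (p F)). r \<le> snd (p F)}"
      using finT[of "fst (p F)"] p[OF F(1)] by (intro Max_in) (auto simp: T_def)
    then show "y \<in> (SIGMA b:\<Gamma>. T b)"
      using F p[OF F(1)] by (auto simp: \<kappa>_def)
  qed
  moreover have "finite (SIGMA b:\<Gamma>. T b)" using finite_curves finT by blast
  ultimately show ?thesis
    using finite_imageD finite_subset by metis
qed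

text \<open>If the curves meet, a crossing puts \<open>i\<close> on both sides of \<open>b\<close>,
  so they meet in exactly two points; these split \<open>i\<close> into two arcs, one inside and one
  outside \<open>b\<close>, and the latter with its ends is the set in question.\<close>

lemma connected_outer_arc:
  assumes "i \<in> \<Gamma>" "b \<in> \<Gamma>" "i \<noteq> b"
  shows "connected (i - inside b)"
proof (cases "i \<inter> b = {}")
  case True
  then show ?thesis
    using connected_avoiding_curve[OF pseudocircle_Jordan(2)[OF pseudocircle[OF assms(1)]], of b]
      Compl_pseudocircle(2)[of b] pseudocircle_Jordan(2)[OF pseudocircle[OF assms(1)]]
    by (metis Diff_eq_empty_iff Diff_triv connected_empty disjoint_iff subsetD)
next
  case False
  then obtain p where p: "p \<in> i" "p \<in> b" by blast
  obtain g where g: "simple_path g" "pathfinish g = pathstart g" "path_image g = i"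
    using pseudocircle[OF assms(1)] by (auto simp: pseudocircle_def)
  have both: "i \<inter> inside b \<noteq> {}" "i \<inter> outside b \<noteq> {}"
  proof -
    obtain h t where h: "loop_onto h i" "0 < t" "t < 1" "h t = p"
      using loop_onto_through[OF pseudocircle[OF assms(1)] p(1)] by metis
    obtain e where e: "0 < e" "e \<le> t" "t + e \<le> 1" and
      sides: "h ` {t-e<..<t} \<subseteq> inside b \<and> h ` {t<..<t+e} \<subseteq> outside b \<or>
       h ` {t-e<..<t} \<subseteq> outside b \<and> h ` {t<..<t+e} \<subseteq> inside b"
      using crosses_at_param[OF pseudocircle[OF assms(2)] finite_Int[OF assms]
          crosses[OF assms(2,1) assms(3)[symmetric] p(2,1)] h] by metis
    have "h (t - e/2) \<in> i" "h (t + e/2) \<in> i"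
      using loop_ontoD(2)[OF h(1)] e h by auto
    moreover have "h (t - e/2) \<in> h ` {t-e<..<t}" "h (t + e/2) \<in> h ` {t<..<t+e}"
      using e by auto
    ultimately show "i \<inter> inside b \<noteq> {}" "i \<inter> outside b \<noteq> {}"
      using sides by blast+
  qed
  \<comment> \<open>With only one common point \<open>p\<close>, the connected set
    \<open>i - {p}\<close> would lie on one side of \<open>b\<close>.\<close>
  obtain q where q: "q \<in> i" "q \<in> b" "q \<noteq> p"
  proof (rule ccontr)
    assume "\<not> thesis"
    then have only: "i \<inter> b = {p}" using p that by blast
    obtain s where s: "s \<in> {0..1}" "g s = p" using p(1) g(3) by (auto simp: path_image_def)
    let ?g = "shiftpath s g"
    have "simple_path ?g" "pathstart ?g = p" "pathfinish ?g = p" "path_image ?g = i"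
      using s g by (auto simp: simple_path_shiftpath pathstart_shiftpath pathfinish_shiftpath path_image_shiftpath)
    then have "connected (i - {p})"
      using connected_simple_path_endless[of ?g] by simp
    then have "i - {p} \<subseteq> inside b \<or> i - {p} \<subseteq> outside b"
      using only by (intro connected_avoiding_curve) blast+
    then show False
      using both p Compl_pseudocircle[of b] by blast
  qed
  obtain u d where ud: "arc u" "arc d" "pathstart u = p" "pathfinish u = q"
      "pathstart d = q" "pathfinish d = p" "path_image u \<inter> path_image d = {p, q}"
      "path_image u \<union> path_image d = i"
    using exists_double_arc[OF g(1,2), of p q] p q g(3) by metis
  have "i \<inter> b = {p, q}"
    using card_Int[OF assms] finite_Int[OF assms] p q
    by (intro card_seteq[symmetric]) (auto simp: card_insert_if)
  then have "(path_image u - {p, q}) \<inter> b = {}" "(path_image d - {p, q}) \<inter> b = {}"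
    using ud(8) by blast+
  moreover have "connected (path_image u - {p, q})" "connected (path_image d - {p, q})"
    using connected_simple_path_endless[OF arc_imp_simple_path] ud by (metis insert_commute)+
  ultimately have "path_image u - {p, q} \<subseteq> inside b \<or> path_image u - {p, q} \<subseteq> outside b"
      "path_image d - {p, q} \<subseteq> inside b \<or> path_image d - {p, q} \<subseteq> outside b"
    by (simp_all add: connected_avoiding_curve)
  moreover have "p \<notin> inside b" "q \<notin> inside b" "p \<notin> outside b" "q \<notin> outside b"
    using p q Compl_pseudocircle[of b] by blast+
  ultimately have "i - inside b = path_image u \<or> i - inside b = path_image d"
    using ud(7,8) both Compl_pseudocircle(2)[of b] by blast
  then show ?thesis
    using ud(1,2) connected_arc_image by metis
qed

subsection \<open>Covered stretches\<close>

text \<open>Only one other curve \<open>c\<close> passes through the vertex and all remaining ones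
  have it in their outside, so nearby coverage is decided by the crossing with
  \<open>c\<close>.\<close>

lemma outer_vertex_one_side:
  assumes b: "b \<in> \<Gamma>" and h: "loop_onto h b" and t: "0 < t" "t < 1" "h t \<in> outer_vertices"
  obtains e where "0 < e" "e \<le> t" "t + e \<le> 1"
    "h ` {t-e<..<t} \<subseteq> covered b \<and> h ` {t<..<t+e} \<inter> covered b = {} \<or>
     h ` {t-e<..<t} \<inter> covered b = {} \<and> h ` {t<..<t+e} \<subseteq> covered b"
proof -
  have hb: "h t \<in> b" using loop_ontoD(2)[OF h] t by auto
  obtain c where c: "c \<in> \<Gamma>" "c \<noteq> b" "h t \<in> c" "\<And>i. i \<in> \<Gamma> \<Longrightarrow> h t \<in> i \<Longrightarrow> i = b \<or> i = c"
    using outer_vertex_other_curve[OF t(3) b hb] by metis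
  obtain e1 where e1: "0 < e1" "e1 \<le> t" "t + e1 \<le> 1" and
    sides: "h ` {t-e1<..<t} \<subseteq> inside c \<and> h ` {t<..<t+e1} \<subseteq> outside c \<or>
       h ` {t-e1<..<t} \<subseteq> outside c \<and> h ` {t<..<t+e1} \<subseteq> inside c"
    using crosses_at_param[OF pseudocircle[OF c(1)] finite_Int[OF b c(1) c(2)[symmetric]]
        crosses[OF c(1) b c(2) c(3) hb] h t(1,2) refl] by metis
  define U where "U = (\<Inter>i\<in>\<Gamma>-{b,c}. outside i)"
  have "open U"
    unfolding U_def using finite_curves pseudocircle_Jordan(9)[OF pseudocircle] by (auto intro!: open_INT)
  moreover have "h t \<in> outside i" if "i \<in> \<Gamma> - {b, c}" for i
  proof -
    have "h t \<notin> i" "h t \<notin> inside i" using c(4)[of i] t(3) that by (auto simp: outer_vertices_def)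
    then show ?thesis using Compl_pseudocircle(1)[of i] by blast
  qed
  then have "h t \<in> U" unfolding U_def by blast
  ultimately obtain d where d: "d > 0" "ball (h t) d \<subseteq> U" using openE by metis
  have "t \<in> {0..1}" using t by simp
  then obtain e2 where e2: "e2 > 0" "\<And>s. s \<in> {0..1} \<Longrightarrow> dist s t < e2 \<Longrightarrow> dist (h s) (h t) < d"
    using loop_ontoD(1)[OF h] d(1) unfolding continuous_on_iff by blast
  define e where "e = min e1 e2"
  have e: "0 < e" "e \<le> e1" "e \<le> t" "t + e \<le> 1" using e1 e2 by (auto simp: e_def)
  have U: "h s \<in> U" if "s \<in> {t-e<..<t+e}" for s
  proof -
    have "s \<in> {0..1}" "dist s t < e2" using that e by (auto simp: dist_real_def e_def)
    then show ?thesis using e2 d(2) by (auto simp: dist_commute)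
  qed
  have cov: "h ` I \<subseteq> covered b" if "h ` I \<subseteq> inside c" for I
    using that c(1,2) unfolding covered_def by blast
  have unc: "h ` I \<inter> covered b = {}" if I: "I \<subseteq> {t-e<..<t+e}" "h ` I \<subseteq> outside c" for I
  proof (rule disjoint_coveredI)
    fix i assume i: "i \<in> \<Gamma> - {b}"
    show "h ` I \<subseteq> outside i"
    proof (cases "i = c")
      case False
      then have "U \<subseteq> outside i" using i unfolding U_def by blast
      then show ?thesis using U I(1) by blast
    qed (use I(2) in simp)
  qed
  have I: "{t-e<..<t} \<subseteq> {t-e<..<t+e}" "{t<..<t+e} \<subseteq> {t-e<..<t+e}" using e by auto
  have J: "{t-e<..<t} \<subseteq> {t-e1<..<t}" "{t<..<t+e} \<subseteq> {t<..<t+e1}" using e by auto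
  from sides have "h ` {t-e<..<t} \<subseteq> inside c \<and> h ` {t<..<t+e} \<subseteq> outside c \<or>
       h ` {t-e<..<t} \<subseteq> outside c \<and> h ` {t<..<t+e} \<subseteq> inside c"
    using image_mono[OF J(1), of h] image_mono[OF J(2), of h] by (meson subset_trans)
  then show thesis
    using that[OF e(1,3,4)] cov unc[OF I(1)] unc[OF I(2)] by metis
qed

text \<open>Reversing the loop if necessary puts the covered side after \<open>v\<close>; then the
  base point is moved onto the uncovered side just before \<open>v\<close>.\<close>

lemma loop_leaving_outer_vertex:
  assumes b: "b \<in> \<Gamma>" and v: "v \<in> outer_vertices" "v \<in> b"
  obtains h t e where "loop_onto h b" "0 < t" "t + e < 1" "0 < e" "h t = v"
    "h ` {0..<t} \<inter> covered b = {}" "h ` {t<..<t+e} \<subseteq> covered b"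
proof -
  have "\<exists>g t e. loop_onto g b \<and> 0 < e \<and> e \<le> t \<and> t + e \<le> 1 \<and> g t = v \<and>
      g ` {t-e<..<t} \<inter> covered b = {} \<and> g ` {t<..<t+e} \<subseteq> covered b"
  proof -
    obtain g t where g: "loop_onto g b" and t: "0 < t" "t < 1" "g t = v"
      using loop_onto_through[OF pseudocircle[OF b] v(2)] by metis
    obtain e where e: "0 < e" "e \<le> t" "t + e \<le> 1" and
     "g ` {t-e<..<t} \<subseteq> covered b \<and> g ` {t<..<t+e} \<inter> covered b = {} \<or>
     g ` {t-e<..<t} \<inter> covered b = {} \<and> g ` {t<..<t+e} \<subseteq> covered b"
      using outer_vertex_one_side[OF b g t(1,2)] v(1) t(3) by metis
    then consider "g ` {t-e<..<t} \<subseteq> covered b \<and> g ` {t<..<t+e} \<inter> covered b = {}"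
      | "g ` {t-e<..<t} \<inter> covered b = {} \<and> g ` {t<..<t+e} \<subseteq> covered b" by blast
    then show ?thesis
    proof cases
      case 1
      let ?g = "reversepath g"
      have "g (1 - s) \<in> g ` {t<..<t+e}" if "s \<in> {1-t-e<..<1-t}" for s
        using that by (intro imageI) auto
      then have im1: "?g ` {1-t-e<..<1-t} \<subseteq> g ` {t<..<t+e}"
        unfolding reversepath_def by blast
      have "g (1 - s) \<in> g ` {t-e<..<t}" if "s \<in> {1-t<..<1-t+e}" for s
        using that by (intro imageI) auto
      then have im2: "?g ` {1-t<..<1-t+e} \<subseteq> g ` {t-e<..<t}"
        unfolding reversepath_def by blast
      have "loop_onto ?g b"
        using g by (auto simp: loop_onto_def simple_path_reversepath)
      moreover have "?g (1 - t) = v" using t by (simp add: reversepath_def)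
      moreover have "?g ` {1-t-e<..<1-t} \<inter> covered b = {}" "?g ` {1-t<..<1-t+e} \<subseteq> covered b"
        by (rule Int_empty_mono[OF im1 conjunct2[OF 1]], rule subset_trans[OF im2 conjunct1[OF 1]])
      moreover have "e \<le> 1 - t" "1 - t + e \<le> 1" using e by linarith+
      ultimately show ?thesis using e(1) by blast
    next
      case 2
      with g e t show ?thesis by blast
    qed
  qed
  then obtain g t e where g: "loop_onto g b" and e: "0 < e" "e \<le> t" "t + e \<le> 1" and v': "g t = v"
    and sides: "g ` {t-e<..<t} \<inter> covered b = {}" "g ` {t<..<t+e} \<subseteq> covered b"
    by blast
  \<comment> \<open>Starting at \<open>t - e/2\<close> puts \<open>v\<close> at parameter
    \<open>e/2\<close>. From \<open>e \<le> t\<close> and \<open>t + e \<le> 1\<close> follows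
    \<open>e \<le> 1/2\<close>, so \<open>e/2 + e/3 < 1\<close>.\<close>
  let ?h = "shiftpath (t - e/2) g"
  have "loop_onto ?h b"
    using g e by (auto simp: loop_onto_def simple_path_shiftpath closed_shiftpath path_image_shiftpath)
  moreover have "?h (e/2) = v" using e v' by (simp add: shiftpath_def)
  moreover have "?h ` {0..<e/2} \<subseteq> g ` {t-e<..<t}"
  proof
    fix y assume "y \<in> ?h ` {0..<e/2}"
    then obtain s where "s \<in> {0..<e/2}" "y = ?h s" by blast
    then have "y = g (t - e/2 + s)" "t - e/2 + s \<in> {t-e<..<t}" using e by (auto simp: shiftpath_def)
    then show "y \<in> g ` {t-e<..<t}" by blast
  qed
  moreover have "?h ` {e/2<..<e/2+e/3} \<subseteq> g ` {t<..<t+e}"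
  proof
    fix y assume "y \<in> ?h ` {e/2<..<e/2+e/3}"
    then obtain s where "s \<in> {e/2<..<e/2+e/3}" "y = ?h s" by blast
    then have "y = g (t - e/2 + s)" "t - e/2 + s \<in> {t<..<t+e}" using e by (auto simp: shiftpath_def)
    then show "y \<in> g ` {t<..<t+e}" by blast
  qed
  moreover have "0 < e/2" "e/2 + e/3 < 1" "0 < e/3" using e by linarith+
  ultimately show thesis
    using that[of ?h "e/2" "e/3"] Int_empty_mono[OF _ sides(1)] subset_trans[OF _ sides(2)] by metis
qed

text \<open>The stretch from \<open>v\<close> ends at the first return to the uncovered part. No
  outer vertex lies strictly within it, because each one has an uncovered side.\<close>

lemma covered_stretch:
  assumes b: "b \<in> \<Gamma>" and v: "v \<in> outer_vertices" "v \<in> b"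
  obtains h t1 t2 t3 where "loop_onto h b" "0 < t1" "t1 < t2" "t2 < t3" "t3 < 1" "h t1 = v"
    "h t2 \<in> outer_vertices" "h ` {0..<t1} \<inter> covered b = {}" "h ` {t2<..<t3} \<inter> covered b = {}"
    "\<And>u. u \<in> outer_vertices \<Longrightarrow> u \<in> b \<Longrightarrow> u = v \<or> u = h t2 \<or> u \<in> h ` {t3..1}"
proof -
  obtain h t1 e1 where h: "loop_onto h b" and t1: "0 < t1" "t1 + e1 < 1" "0 < e1" "h t1 = v"
    and left: "h ` {0..<t1} \<inter> covered b = {}" and right: "h ` {t1<..<t1+e1} \<subseteq> covered b"
    using loop_leaving_outer_vertex[OF assms] by metis
  have vert_cov: "u \<in> covered b" if u: "u \<in> outer_vertices" "u \<in> b" for u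
  proof -
    obtain c where "c \<in> \<Gamma>" "c \<noteq> b" "u \<in> c" using outer_vertex_other_curve[OF u(1) b u(2)] by metis
    then show ?thesis unfolding covered_def by blast
  qed
  have near: "\<exists>e>0. \<forall>s\<in>{0..1}. \<bar>s - t\<bar> < e \<longrightarrow> h s \<in> V" if V: "open V" "h t \<in> V" and tI: "t \<in> {0..1}" for V t
  proof -
    obtain d where d: "d > 0" "ball (h t) d \<subseteq> V" using openE[OF V] by metis
    obtain e where "e > 0" "\<And>s. s \<in> {0..1} \<Longrightarrow> dist s t < e \<Longrightarrow> dist (h s) (h t) < d"
      using loop_ontoD(1)[OF h] d(1) tI unfolding continuous_on_iff by blast
    then show ?thesis
      using d(2) by (intro exI[of _ e]) (auto simp: dist_real_def dist_commute)
  qed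
  have opencov: "open (- covered b)" using closed_covered by blast
  \<comment> \<open>Nonempty: parameter 1 is the base point, which is uncovered.\<close>
  define U where "U = {s \<in> {t1..1}. h s \<notin> covered b}"
  define t2 where "t2 = Inf U"
  have "h 0 \<notin> covered b" using left t1 by force
  then have U1: "1 \<in> U" using loop_ontoD(3)[OF h] t1 by (auto simp: U_def)
  have bdd: "bdd_below U" by (auto simp: U_def bdd_below_def)
  have low: "h s \<in> covered b" if "t1 \<le> s" "s < t2" for s
  proof (rule ccontr)
    assume "h s \<notin> covered b"
    moreover have "t2 \<le> 1" unfolding t2_def using cInf_lower[OF U1 bdd] .
    ultimately have "s \<in> U" using that by (auto simp: U_def)
    then have "t2 \<le> s" unfolding t2_def by (rule cInf_lower[OF _ bdd])
    then show False using that by simp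
  qed
  have vc: "h t1 \<in> covered b" using vert_cov v t1 by simp
  have "t1 + e1 \<le> t2"
    unfolding t2_def
  proof (rule cInf_greatest)
    show "U \<noteq> {}" using U1 by blast
    fix s assume "s \<in> U"
    then have sU: "h s \<notin> covered b" "t1 \<le> s" by (auto simp: U_def)
    then have "s \<notin> {t1<..<t1+e1}" using right by blast
    moreover have "s \<noteq> t1" using sU vc by blast
    moreover note sU(2)
    ultimately show "t1 + e1 \<le> s" by auto
  qed
  then have t12: "t1 < t2" using t1 by linarith
  have t2le: "t2 \<le> 1" unfolding t2_def using cInf_lower[OF U1 bdd] .
  then have t2I: "t2 \<in> {0..1}" using t12 t1 by auto
  have t2cov: "h t2 \<in> covered b"
  proof (rule ccontr)
    assume "h t2 \<notin> covered b"
    then obtain e where e: "e > 0" "\<And>s. s \<in> {0..1} \<Longrightarrow> \<bar>s - t2\<bar> < e \<Longrightarrow> h s \<in> - covered b"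
      using near[OF opencov _ t2I] by auto
    define s where "s = t2 - min e (t2 - t1) / 2"
    have "t1 \<le> s" "s < t2" "\<bar>s - t2\<bar> < e" using e(1) t12 by (auto simp: s_def min_def field_simps)
    moreover have "s \<in> {0..1}" using calculation t1 t2le by auto
    ultimately show False using e(2) low by blast
  qed
  then have "t2 \<noteq> 1" using \<open>h 0 \<notin> covered b\<close> loop_ontoD(3)[OF h] by auto
  then have t2lt: "t2 < 1" using t2le by simp
  have approach: "\<exists>s. t2 < s \<and> s < t2 + e \<and> s \<in> {0..1} \<and> h s \<notin> covered b" if "e > 0" for e
  proof -
    have "U \<noteq> {}" "Inf U < t2 + e" using U1 that by (auto simp: t2_def)
    then obtain s where s: "s \<in> U" "s < t2 + e" by (metis cInf_lessD)
    moreover have "t2 \<le> s" unfolding t2_def using cInf_lower[OF s(1) bdd] .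
    moreover have "s \<noteq> t2" using s t2cov by (auto simp: U_def)
    ultimately show ?thesis using t1 by (intro exI[of _ s]) (auto simp: U_def)
  qed
  have t2pos: "0 < t2" using t1 t12 by linarith
  have hb: "h t2 \<in> b" using loop_ontoD(2)[OF h] t2I by blast
  \<comment> \<open>Uncovered parameters accumulate at \<open>t2\<close> from the right, whereas the
    open inside of \<open>k\<close> would cover a neighbourhood. As \<open>h t2\<close> is itself
    covered, it must lie on another curve.\<close>
  have notin: "h t2 \<notin> inside k" if k: "k \<in> \<Gamma>" for k
  proof (cases "k = b")
    case True
    then show ?thesis using hb Compl_pseudocircle(3)[of b] by blast
  next
    case False
    show ?thesis
    proof
      assume "h t2 \<in> inside k"
      then obtain e where e: "e > 0" "\<And>s. s \<in> {0..1} \<Longrightarrow> \<bar>s - t2\<bar> < e \<Longrightarrow> h s \<in> inside k"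
        using near[OF pseudocircle_Jordan(5)[OF pseudocircle[OF k]] _ t2I] by auto
      obtain s where s: "t2 < s" "s < t2 + e" "s \<in> {0..1}" "h s \<notin> covered b"
        using approach[OF e(1)] by blast
      then have "h s \<in> inside k" using e(2)[of s] by auto
      then show False using s(4) k False unfolding covered_def by blast
    qed
  qed
  obtain c where "c \<in> \<Gamma> - {b}" "h t2 \<in> c"
    using t2cov notin unfolding covered_def by blast
  then have "h t2 \<in> vertices \<Gamma>" using hb b unfolding vertices_def by blast
  then have t2V: "h t2 \<in> outer_vertices" using notin by (simp add: outer_vertices_def)
  obtain e where e: "0 < e" "e \<le> t2" "t2 + e \<le> 1" and
    "h ` {t2-e<..<t2} \<subseteq> covered b \<and> h ` {t2<..<t2+e} \<inter> covered b = {} \<or>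
     h ` {t2-e<..<t2} \<inter> covered b = {} \<and> h ` {t2<..<t2+e} \<subseteq> covered b"
    using outer_vertex_one_side[OF b h t2pos t2lt t2V] by metis
  moreover have "\<not> h ` {t2<..<t2+e} \<subseteq> covered b"
    using approach[OF e(1)] by (meson greaterThanLessThan_iff imageI subsetD)
  ultimately have right2: "h ` {t2<..<t2+e} \<inter> covered b = {}" by blast
  have t3: "t2 < t2 + e/2" "t2 + e/2 < 1" using e by auto
  have cases: "u = v \<or> u = h t2 \<or> u \<in> h ` {t2+e/2..1}" if u: "u \<in> outer_vertices" "u \<in> b" for u
  proof -
    obtain s where s: "s \<in> {0..1}" "u = h s" using u(2) loop_ontoD(2)[OF h] by blast
    have uc: "h s \<in> covered b" using vert_cov u s by simp
    have "s \<notin> {0..<t1}" "s \<notin> {t2<..<t2+e}" using left right2 uc by blast+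
    moreover have "\<not> (t1 < s \<and> s < t2)"
    proof
      assume st: "t1 < s \<and> s < t2"
      then obtain d where d: "0 < d" and
        sides: "h ` {s-d<..<s} \<inter> covered b = {} \<or> h ` {s<..<s+d} \<inter> covered b = {}"
        using outer_vertex_one_side[OF b h, of s] u(1) s t1 t2lt by (metis less_trans)
      define r where "r = min d (min (s - t1) (t2 - s)) / 2"
      have r: "0 < r" "r < d" "t1 < s - r" "s + r < t2" using d st by (auto simp: r_def min_def field_simps)
      then have "h (s - r) \<in> covered b" "h (s + r) \<in> covered b" using low by auto
      moreover have "h (s - r) \<in> h ` {s-d<..<s}" "h (s + r) \<in> h ` {s<..<s+d}" using r by auto
      ultimately show False using sides by blast
    qed
    ultimately have "s = t1 \<or> s = t2 \<or> s \<in> {t2+e/2..1}" using s(1) e(1) by auto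
    then show ?thesis using s(2) t1(4) by blast
  qed
  have "{t2<..<t2+e/2} \<subseteq> {t2<..<t2+e}" using e by auto
  then have "h ` {t2<..<t2+e/2} \<inter> covered b = {}" using right2 by blast
  then show thesis
    using that[OF h t1(1) t12 t3 t1(4) t2V left _ cases] by blast
qed

text \<open>The boundary point \<open>x\<close> adheres to \<open>F\<close> and to
  \<open>inside b\<close>, so adding it alone joins the two.\<close>

lemma gate_connected:
  assumes b: "b \<in> \<Gamma>" and F: "F \<in> outer_faces" and x: "x \<in> b" "x \<in> closure F"
  shows "connected (insert x (F \<union> inside b))"
proof -
  have "connected F" using F by (auto simp: outer_faces_def intro: in_components_connected)
  then have "connected (insert x F)"
    using x(2) closure_subset[of F] by (intro connected_intermediate_closure[of F "insert x F"]) auto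
  moreover have "x \<in> closure (inside b)"
    using pseudocircle_Jordan(8)[OF pseudocircle[OF b]] x(1) by (auto simp: frontier_def)
  then have "connected (insert x (inside b))"
    using pseudocircle_Jordan(6)[OF pseudocircle[OF b]] closure_subset[of "inside b"]
    by (intro connected_intermediate_closure[of "inside b" "insert x (inside b)"]) auto
  ultimately have "connected (insert x F \<union> insert x (inside b))"
    by (rule connected_Un) auto
  then show ?thesis by simp
qed

lemma outer_face_angle_fun:
  assumes "w \<in> F" "F \<in> outer_faces" "w' \<in> F'" "F' \<in> outer_faces" "i \<in> \<Gamma>"
  shows "\<exists>L. angle_fun i w w' L"
proof -
  have w: "w \<in> outside i" "w' \<in> outside i" using assms by (auto simp: outer_faces_def)
  have "connected_component (- i) w w'"
    unfolding connected_component_def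
    using w pseudocircle_Jordan(10)[OF pseudocircle[OF assms(5)]] Compl_pseudocircle(4)[of i] by blast
  then show ?thesis
    using angle_fun_exists_iff[OF pseudocircle_Jordan(1)[OF pseudocircle[OF assms(5)]]] w Compl_pseudocircle(4)[of i]
    by blast
qed

lemma vertex_on_outer_arc:
  assumes "u \<in> outer_vertices" "i \<in> \<Gamma>" "u \<in> i" "b \<in> \<Gamma>"
  shows "u \<in> i - inside b"
  using assms by (auto simp: outer_vertices_def)

text \<open>All branches are compared with one reference function: on the curves other than
  \<open>b\<close> they can be matched with it at every outer vertex, while on \<open>b\<close>
  matching beyond the stretch forces a mismatch on the stretch itself.\<close>

lemma jump_at_stretch_ends:
  assumes b: "b \<in> \<Gamma>" and v: "v \<in> outer_vertices" "v \<in> b"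
  obtains v' w w' F F' L where "v' \<in> outer_vertices" "v' \<noteq> v" "F \<in> outer_faces" "F' \<in> outer_faces"
    "w \<in> F" "w' \<in> F'" "\<And>i. i \<in> \<Gamma> \<Longrightarrow> angle_fun i w w' (L i)"
    "\<And>u i j. u \<in> outer_vertices \<Longrightarrow> i \<in> \<Gamma> \<Longrightarrow> j \<in> \<Gamma> \<Longrightarrow> i \<noteq> j \<Longrightarrow> u \<in> i \<Longrightarrow> u \<in> j \<Longrightarrow>
       L i u \<noteq> L j u \<longleftrightarrow> u = v \<or> u = v'"
proof -
  obtain h t1 t2 t3 where h: "loop_onto h b" and t: "0 < t1" "t1 < t2" "t2 < t3" "t3 < 1" and ht1: "h t1 = v"
    and v': "h t2 \<in> outer_vertices" and unc1: "h ` {0..<t1} \<inter> covered b = {}"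
    and unc2: "h ` {t2<..<t3} \<inter> covered b = {}"
    and vb: "\<And>u. u \<in> outer_vertices \<Longrightarrow> u \<in> b \<Longrightarrow> u = v \<or> u = h t2 \<or> u \<in> h ` {t3..1}"
    using covered_stretch[OF assms] by metis
  define v' where "v' = h t2"
  \<comment> \<open>\<open>P\<close> is the covered stretch, \<open>Q\<close> carries all other outer vertices of \<open>b\<close>, and the arcs \<open>A\<close>, \<open>B\<close>
    between them are two gates from the inside of \<open>b\<close> into the outer faces \<open>F\<close>, \<open>F'\<close>. All of \<open>C\<close> is
    avoided by walking from \<open>F\<close> through the gates to \<open>F'\<close>.\<close>
  define P Q A B where "P = h ` {t1..t2}" and "Q = h ` {t3..1}" and "A = h ` {0..t1}" and "B = h ` {t2..t3}"
  define x y where "x = h (t1/2)" and "y = h ((t2+t3)/2)"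
  define X where "X = (\<Union>i\<in>\<Gamma>-{b}. i - inside b)"
  define C where "C = X \<union> P \<union> Q"
  have cont: "compact (h ` {r..s})" "connected (h ` {r..s})" if "0 \<le> r" "s \<le> 1" for r s
    using that by (auto intro!: compact_continuous_image connected_continuous_image
        continuous_on_subset[OF loop_ontoD(1)[OF h]])
  have PQ: "compact P" "connected P" "compact Q" "connected Q" "compact A" "connected A" "compact B" "connected B"
    unfolding P_def Q_def A_def B_def using t by (auto intro!: cont)
  have "{0..1} = {0..t1} \<union> {t1..t2} \<union> {t2..t3} \<union> {t3..1::real}" using t by auto
  then have b_eq: "b = A \<union> P \<union> B \<union> Q"
    unfolding P_def Q_def A_def B_def using loop_ontoD(2)[OF h] by (metis image_Un)
  then have bsub: "A \<subseteq> b" "P \<subseteq> b" "B \<subseteq> b" "Q \<subseteq> b" by blast+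
  have inj: "h r \<noteq> h s" if "r \<in> {0..1}" "0 < s" "s < 1" "r \<noteq> s" for r s
    using loop_onto_inj[OF h] that by auto
  have vP: "v \<in> P" "v' \<in> P" "v' \<noteq> v"
    using t ht1 inj[of t2 t1] by (auto simp: P_def v'_def)
  have disj: "h ` I \<inter> h ` J = {}" if "I \<subseteq> {0<..<1}" "J \<subseteq> {0..1}" "I \<inter> J = {}" for I J
  proof -
    have "h s \<noteq> h r" if "s \<in> I" "r \<in> J" for s r
      using inj[of r s] that \<open>I \<subseteq> _\<close> \<open>J \<subseteq> _\<close> \<open>I \<inter> J = {}\<close> by (metis atLeastAtMost_iff disjoint_iff greaterThanLessThan_iff subsetD)
    then show ?thesis by blast
  qed
  have PQ0: "P \<inter> Q = {}"
    unfolding P_def Q_def by (rule disj) (use t in auto)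
  have "B \<inter> A = {}"
    unfolding A_def B_def by (rule disj) (use t in auto)
  then have AB: "A \<inter> B = {}" by blast
  have xC: "x \<notin> P \<union> Q \<union> B"
  proof -
    have "h ` {t1/2} \<inter> h ` ({t1..t2} \<union> {t3..1} \<union> {t2..t3}) = {}"
      by (rule disj) (use t in auto)
    then show ?thesis unfolding P_def Q_def B_def x_def by blast
  qed
  have yC: "y \<notin> P \<union> Q \<union> A"
  proof -
    have "h ` {(t2+t3)/2} \<inter> h ` ({t1..t2} \<union> {t3..1} \<union> {0..t1}) = {}"
      by (rule disj) (use t in auto)
    then show ?thesis unfolding P_def Q_def A_def y_def by blast
  qed
  have xb: "x \<in> b" "x \<notin> covered b" and yb: "y \<in> b" "y \<notin> covered b"
  proof -
    have "t1/2 \<in> {0..<t1}" "(t2+t3)/2 \<in> {t2<..<t3}" using t by auto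
    then show "x \<notin> covered b" "y \<notin> covered b" unfolding x_def y_def using unc1 unc2 by blast+
    have "t1/2 \<in> {0..1}" "(t2+t3)/2 \<in> {0..1}" using t by auto
    then show "x \<in> b" "y \<in> b" unfolding x_def y_def using loop_ontoD(2)[OF h] by blast+
  qed
  have Xcov: "X \<subseteq> covered b" by (auto simp: X_def covered_def)
  have Xin: "X \<inter> inside b = {}" by (auto simp: X_def)
  have closX: "compact (i - inside b)" if "i \<in> \<Gamma>" for i
    using pseudocircle_Jordan(1)[OF pseudocircle[OF that]] pseudocircle_Jordan(5)[OF pseudocircle[OF b]]
    by (rule compact_diff)
  then have "compact X" unfolding X_def using finite_curves by (intro compact_UN) auto
  then have compC: "compact C" unfolding C_def using PQ by (intro compact_Un)
  have bX: "b \<inter> X \<subseteq> P \<union> Q"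
  proof
    fix z assume z: "z \<in> b \<inter> X"
    then obtain s where s: "s \<in> {0..1}" "z = h s" using loop_ontoD(2)[OF h] by blast
    have "h s \<in> covered b" using z s Xcov by blast
    then have "s \<notin> {0..<t1}" "s \<notin> {t2<..<t3}" using unc1 unc2 by blast+
    then have "s \<in> {t1..t2} \<union> {t3..1}" using s(1) by auto
    then show "z \<in> P \<union> Q" unfolding P_def Q_def s(2) by blast
  qed
  have Csub: "C \<subseteq> \<Union>\<Gamma>" using b bsub unfolding C_def X_def by blast
  obtain F where F: "F \<in> outer_faces" "x \<in> closure F" using outer_face_at[OF b xb] by metis
  obtain F' where F': "F' \<in> outer_faces" "y \<in> closure F'" using outer_face_at[OF b yb] by metis
  have Fdis: "G \<inter> \<Union>\<Gamma> = {}" "G \<noteq> {}" "connected G" if "G \<in> outer_faces" for G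
    using that in_components_subset[of G] in_components_nonempty[of G] in_components_connected[of G]
    by (auto simp: outer_faces_def)
  have inb: "inside b \<inter> (C \<union> b) = {}"
    using Xin Compl_pseudocircle(3)[of b] bsub unfolding C_def by blast
  \<comment> \<open>\<open>F\<close> is left through a point of \<open>A\<close> only, and
    \<open>F'\<close> below through a point of \<open>B\<close> only; \<open>C\<close> is missed
    because it contains nothing inside \<open>b\<close>.\<close>
  have gx: "insert x (F \<union> inside b) \<inter> (C \<union> B) = {}"
  proof -
    have "x \<notin> C \<union> B" using xC xb Xcov unfolding C_def by blast
    moreover have "F \<inter> (C \<union> B) = {}" using Fdis(1)[OF F(1)] Csub b bsub by blast
    moreover have "inside b \<inter> (C \<union> B) = {}" using inb bsub by blast
    ultimately show ?thesis by blast
  qed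
  have gy: "insert y (F' \<union> inside b) \<inter> (C \<union> A) = {}"
  proof -
    have "y \<notin> C \<union> A" using yC yb Xcov unfolding C_def by blast
    moreover have "F' \<inter> (C \<union> A) = {}" using Fdis(1)[OF F'(1)] Csub b bsub by blast
    moreover have "inside b \<inter> (C \<union> A) = {}" using inb bsub by blast
    ultimately show ?thesis by blast
  qed
  have conx: "connected (insert x (F \<union> inside b))" by (rule gate_connected[OF b F(1) xb(1) F(2)])
  have cony: "connected (insert y (F' \<union> inside b))" by (rule gate_connected[OF b F'(1) yb(1) F'(2)])
  obtain z0 where z0: "z0 \<in> inside b" using pseudocircle_Jordan(7)[OF pseudocircle[OF b]] by blast
  obtain w where w: "w \<in> F" using Fdis(2)[OF F(1)] by blast
  obtain w' where w': "w' \<in> F'" using Fdis(2)[OF F'(1)] by blast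
  have arcC: "i - inside b \<subseteq> C" if "i \<in> \<Gamma>" "i \<noteq> b" for i
    using that by (auto simp: C_def X_def)
  have vb_iff: "u \<in> P \<longleftrightarrow> u = v \<or> u = v'" "u \<in> Q \<longleftrightarrow> u \<noteq> v \<and> u \<noteq> v'"
    if "u \<in> outer_vertices" "u \<in> b" for u
    using vb[OF that] vP PQ0 unfolding Q_def[symmetric] v'_def[symmetric] by blast+
  have v'V: "v' \<in> outer_vertices" "v' \<in> b" using v' vP bsub unfolding v'_def by blast+
  note obtained = that
  \<comment> \<open>\<open>\<Lambda>\<close> is the common reference. The differences then vanish at
    all outer vertices off \<open>b\<close> and on \<open>Q\<close>; the outer vertices on
    \<open>P\<close> are exactly \<open>v\<close> and \<open>v'\<close>.\<close>
  have key: thesis if L: "\<And>i. i \<in> \<Gamma> \<Longrightarrow> angle_fun i u u' (L i)" and u: "u \<in> F" "u' \<in> F'"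
    and other: "\<And>i z. i \<in> \<Gamma> \<Longrightarrow> i \<noteq> b \<Longrightarrow> z \<in> i \<Longrightarrow> z \<in> outer_vertices \<Longrightarrow> L i z = \<Lambda> z"
    and atP: "\<And>z. z \<in> P \<Longrightarrow> z \<in> outer_vertices \<Longrightarrow> L b z \<noteq> \<Lambda> z"
    and atQ: "\<And>z. z \<in> Q \<Longrightarrow> z \<in> outer_vertices \<Longrightarrow> L b z = \<Lambda> z" for u u' L and \<Lambda> :: "complex \<Rightarrow> real"
  proof (rule obtained[OF v'V(1) vP(3) F(1) F'(1) u L])
    fix z i j assume z: "z \<in> outer_vertices" and ij: "i \<in> \<Gamma>" "j \<in> \<Gamma>" "i \<noteq> j" "z \<in> i" "z \<in> j"
    have Lb: "L b z \<noteq> \<Lambda> z \<longleftrightarrow> z = v \<or> z = v'" if "z \<in> b"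
      using vb_iff[OF z that] atP[OF _ z] atQ[OF _ z] by blast
    consider "i = b" "j \<noteq> b" | "j = b" "i \<noteq> b" | "i \<noteq> b" "j \<noteq> b" using ij(3) by blast
    then show "L i z \<noteq> L j z \<longleftrightarrow> z = v \<or> z = v'"
    proof cases
      case 1
      then show ?thesis using Lb ij other[of j z] z by auto
    next
      case 2
      then show ?thesis using Lb ij other[of i z] z by auto
    next
      case 3
      then have "z \<notin> b" using no_triple[OF ij(1,2) b ij(4,5)] ij(3) by blast
      then have "z \<noteq> v" "z \<noteq> v'" using v(2) v'V(2) by auto
      then show ?thesis using 3 ij other[of i z] other[of j z] z by simp
    qed
  qed
  show thesis
  proof (cases "F = F'")
    case True
    \<comment> \<open>The walk closes up within \<open>F\<close>, so it separates \<open>P\<close> from \<open>Q\<close>, and locally constant angle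
      functions (\<open>w' = w\<close>) suffice.\<close>
    define K where "K = connected_component_set C v"
    have vC: "v \<in> C" using vP by (simp add: C_def)
    have K: "connected K" "K \<subseteq> C" "v \<in> K" "closed K"
      using vC compC by (auto simp: K_def connected_component_subset closed_connected_component compact_imp_closed)
    have absorb: "T \<subseteq> K" if T: "connected T" "T \<subseteq> C" "T \<inter> K \<noteq> {}" for T
    proof -
      obtain z where z: "z \<in> T" "z \<in> K" using T(3) by blast
      then have "connected_component_set C z = K" unfolding K_def by (metis connected_component_eq)
      then show ?thesis using connected_component_maximal[OF z(1) T(1,2)] by simp
    qed
    have PK: "P \<subseteq> K" using absorb[of P] PQ(2) vP K by (auto simp: C_def)
    have QK: "Q \<inter> K = {}"
    proof (rule ccontr)
      assume "Q \<inter> K \<noteq> {}"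
      then have "Q \<subseteq> K" using absorb[of Q] PQ(4) by (auto simp: C_def)
      have compK: "compact K" using closed_Int_compact[OF K(4) compC] K(2) by (simp add: Int_absorb2)
      \<comment> \<open>As \<open>F = F'\<close>, the gate at \<open>y\<close> joins
        \<open>w\<close> to \<open>z0\<close> off \<open>K \<union> A\<close> and the gate at
        \<open>x\<close> does so off \<open>K \<union> B\<close>. If \<open>K\<close> contained
        \<open>P\<close> and \<open>Q\<close>, the union would contain \<open>b\<close>, which
        separates \<open>w\<close> from \<open>z0\<close>.\<close>
      have "connected_component (- ((K \<union> A) \<union> (K \<union> B))) w z0"
      proof (rule Janiszewski)
        show "compact (K \<union> A)" "closed (K \<union> B)"
          using compK PQ by (auto intro: compact_imp_closed)
        have "(K \<union> A) \<inter> (K \<union> B) = K" using AB by blast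
        then show "connected ((K \<union> A) \<inter> (K \<union> B))" using K by simp
        show "connected_component (- (K \<union> A)) w z0"
          unfolding connected_component_def
          using cony gy K(2) w z0 True by (intro exI[of _ "insert y (F' \<union> inside b)"]) blast
        show "connected_component (- (K \<union> B)) w z0"
          unfolding connected_component_def
          using conx gx K(2) w z0 by (intro exI[of _ "insert x (F \<union> inside b)"]) blast
      qed
      then have "connected_component (- b) w z0"
        by (rule connected_component_of_subset) (use b_eq PK \<open>Q \<subseteq> K\<close> in blast)
      then obtain T where T: "connected T" "T \<subseteq> - b" "w \<in> T" "z0 \<in> T"
        unfolding connected_component_def by blast
      have "w \<in> outside b" using w F(1) b by (auto simp: outer_faces_def)
      then show False
        using connected_avoiding_curve[of T b] T z0 Compl_pseudocircle(2)[of b] by blast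
    qed
    \<comment> \<open>The curves whose outer arc lies in the component of the stretch get 2 pi, all
      others 0. Giving \<open>b\<close> the value 0 is right on \<open>Q\<close> and wrong on
      \<open>P\<close>.\<close>
    define L :: "complex set \<Rightarrow> complex \<Rightarrow> real"
      where "L i = (\<lambda>_. if i \<noteq> b \<and> (i - inside b) \<inter> K \<noteq> {} then 2 * pi else 0)" for i
    show thesis
    proof (rule key[of w w L "\<lambda>z. if z \<in> K then 2 * pi else 0"])
      show "angle_fun i w w (L i)" for i
        unfolding L_def by (rule angle_fun_refl) (simp add: complex_eq_iff)
      show "w \<in> F" "w \<in> F'" using w True by auto
      fix i z assume i: "i \<in> \<Gamma>" "i \<noteq> b" "z \<in> i" "z \<in> outer_vertices"
      have z: "z \<in> i - inside b" by (rule vertex_on_outer_arc[OF i(4,1,3) b])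
      have "i - inside b \<subseteq> K" if "(i - inside b) \<inter> K \<noteq> {}"
        by (rule absorb[OF connected_outer_arc[OF i(1) b i(2)] arcC[OF i(1,2)] that])
      then show "L i z = (if z \<in> K then 2 * pi else 0)"
        unfolding L_def using z i(2) by (auto split: if_splits)
    next
      fix z
      show "z \<in> P \<Longrightarrow> L b z \<noteq> (if z \<in> K then 2 * pi else 0)"
        using PK by (auto simp: L_def)
      show "z \<in> Q \<Longrightarrow> L b z = (if z \<in> K then 2 * pi else 0)"
        using QK by (auto simp: L_def)
    qed
  next
    case False
    \<comment> \<open>An angle function exists on \<open>C\<close>; it cannot extend over \<open>b\<close>, as \<open>F\<close> and \<open>F'\<close> are different
      faces, so along \<open>b\<close> it differs between \<open>P\<close> and \<open>Q\<close>.\<close>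
    have wC: "w \<notin> \<Union>\<Gamma>" "w' \<notin> \<Union>\<Gamma>" using Fdis(1) F F' w w' by blast+
    have "connected (insert x (F \<union> inside b) \<union> insert y (F' \<union> inside b))"
      using conx cony z0 by (intro connected_Un) blast+
    then have "connected_component (- C) w w'"
      unfolding connected_component_def using gx gy w w'
      by (intro exI[of _ "insert x (F \<union> inside b) \<union> insert y (F' \<union> inside b)"]) blast
    moreover have "w \<notin> C" "w' \<notin> C" using wC Csub by blast+
    ultimately obtain \<Lambda> where \<Lambda>: "angle_fun C w w' \<Lambda>"
      using angle_fun_exists_iff[OF compC] by blast
    \<comment> \<open>Adding a multiple of 2 pi makes a branch on \<open>i\<close> agree with
      \<open>\<Lambda>\<close> on one connected common part, and in general on one only.\<close>
    have adjust: "\<exists>L. angle_fun i w w' L \<and> (\<forall>z\<in>T. L z = \<Lambda> z)"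
      if i: "i \<in> \<Gamma>" and T: "connected T" "T \<subseteq> i" "T \<subseteq> C" for i T
    proof -
      obtain M where M: "angle_fun i w w' M"
        using outer_face_angle_fun[OF w F(1) w' F'(1) i] by blast
      have "w' \<notin> T" using wC i T(2) by blast
      then obtain k where k: "cis k = 1" "\<And>z. z \<in> T \<Longrightarrow> \<Lambda> z = M z + k"
        using angle_fun_unique[OF \<Lambda> M T(1) T(3) T(2)] by metis
      then show ?thesis
        using angle_fun_add_period[OF M k(1)] by (intro exI[of _ "\<lambda>z. M z + k"]) simp
    qed
    have "\<exists>L. angle_fun i w w' L \<and> (\<forall>z\<in>i - inside b. L z = \<Lambda> z)" if "i \<in> \<Gamma> - {b}" for i
      using that by (intro adjust connected_outer_arc b arcC) auto
    then obtain L0 where L0: "\<And>i. i \<in> \<Gamma> - {b} \<Longrightarrow> angle_fun i w w' (L0 i) \<and> (\<forall>z\<in>i - inside b. L0 i z = \<Lambda> z)"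
      by metis
    obtain Lb where Lb: "angle_fun b w w' Lb" "\<And>z. z \<in> Q \<Longrightarrow> Lb z = \<Lambda> z"
      using adjust[OF b PQ(4) bsub(4)] unfolding C_def by blast
    have "P \<subseteq> b" "P \<subseteq> C" "w' \<notin> P" using bsub wC b unfolding C_def by blast+
    then obtain \<kappa> where \<kappa>: "\<And>z. z \<in> P \<Longrightarrow> Lb z = \<Lambda> z + \<kappa>"
      using angle_fun_unique[OF Lb(1) \<Lambda> PQ(2)] by metis
    have "\<kappa> \<noteq> 0"
    proof
      assume "\<kappa> = 0"
      have "b \<inter> C \<subseteq> P \<union> Q" using bX by (auto simp: C_def)
      then have "Lb z = \<Lambda> z" if "z \<in> b \<inter> C" for z
        using that \<kappa> Lb(2) \<open>\<kappa> = 0\<close> by auto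
      then have "\<exists>N. angle_fun (b \<union> C) w w' N"
        using angle_fun_glue[OF _ _ Lb(1) \<Lambda>] compC pseudocircle_Jordan(1)[OF pseudocircle[OF b]]
        by (meson compact_imp_closed)
      moreover have "b \<union> C \<subseteq> \<Union>\<Gamma>" using Csub b by blast
      then have "w \<notin> b \<union> C" "w' \<notin> b \<union> C" using wC by blast+
      moreover have "compact (b \<union> C)"
        using compC pseudocircle_Jordan(1)[OF pseudocircle[OF b]] by (simp add: compact_Un)
      ultimately have "connected_component (- (b \<union> C)) w w'"
        using angle_fun_exists_iff by blast
      then obtain T where T: "connected T" "T \<subseteq> - (b \<union> C)" "w \<in> T" "w' \<in> T"
        unfolding connected_component_def by blast
      have "w \<in> outside b" using w F(1) b by (auto simp: outer_faces_def)
      moreover have "T \<subseteq> inside b \<or> T \<subseteq> outside b"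
        using T by (intro connected_avoiding_curve) blast+
      \<comment> \<open>The parts of curves missing from \<open>C\<close> lie in
        \<open>inside b\<close>, so a connection off \<open>b \<union> C\<close> that stays outside
        \<open>b\<close> avoids all curves.\<close>
      ultimately have "T \<inter> inside b = {}" using T(3) Compl_pseudocircle(2)[of b] by blast
      then have "T \<inter> i = {}" if "i \<in> \<Gamma>" for i
        using arcC[OF that] T(2) by (cases "i = b") blast+
      then have T': "T \<subseteq> - \<Union>\<Gamma>" by blast
      have comp: "F \<in> components (- \<Union>\<Gamma>)" "F' \<in> components (- \<Union>\<Gamma>)"
        using F F' by (auto simp: outer_faces_def)
      have "T \<subseteq> F" using components_maximal[OF comp(1) T(1) T'] T(3) w by blast
      then have "F \<inter> F' \<noteq> {}" using T(4) w' by blast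
      then show False using components_nonoverlap[OF comp] False by blast
    qed
    show thesis
    proof (rule key[of w w' "\<lambda>i. if i = b then Lb else L0 i" \<Lambda>])
      show "angle_fun i w w' (if i = b then Lb else L0 i)" if "i \<in> \<Gamma>" for i
        using Lb L0 that by simp
      show "w \<in> F" "w' \<in> F'" by fact+
      fix i z assume i: "i \<in> \<Gamma>" "i \<noteq> b" "z \<in> i" "z \<in> outer_vertices"
      then show "(if i = b then Lb else L0 i) z = \<Lambda> z"
        using L0[of i] vertex_on_outer_arc[OF i(4,1,3) b] by simp
    next
      fix z
      show "z \<in> P \<Longrightarrow> (if b = b then Lb else L0 b) z \<noteq> \<Lambda> z" using \<kappa> \<open>\<kappa> \<noteq> 0\<close> by simp
      show "z \<in> Q \<Longrightarrow> (if b = b then Lb else L0 b) z = \<Lambda> z" using Lb by simp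
    qed
  qed
qed

subsection \<open>The bound\<close>

text \<open>Any branch from \<open>w\<close> to \<open>w'\<close> is, up to a constant on each
  curve, a sum along the chain \<open>w\<close>, \<open>\<rho> F\<close>, \<open>\<rho> W0\<close>,
  \<open>\<rho> F'\<close>, \<open>w'\<close>. The constants give generators indexed by curves, the
  middle links generators indexed by faces.\<close>

lemma card_outer_vertices_le:
  assumes "\<Gamma> \<noteq> {}" and ne: "outer_vertices \<noteq> {}"
  shows "outer_faces \<noteq> {}"
    and "card outer_vertices \<le> 2 * ((card \<Gamma> - 1) + (card outer_faces - 1))"
proof -
  have "\<forall>u\<in>outer_vertices. \<exists>p. fst p \<in> \<Gamma> \<and> snd p \<in> \<Gamma> \<and> fst p \<noteq> snd p \<and> u \<in> fst p \<and> u \<in> snd p"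
    by (auto simp: outer_vertices_def vertices_def)
  then obtain p where p: "\<And>u. u \<in> outer_vertices \<Longrightarrow>
      fst (p u) \<in> \<Gamma> \<and> snd (p u) \<in> \<Gamma> \<and> fst (p u) \<noteq> snd (p u) \<and> u \<in> fst (p u) \<and> u \<in> snd (p u)"
    by metis
  define \<alpha> \<beta> where "\<alpha> u = fst (p u)" and "\<beta> u = snd (p u)" for u
  have \<alpha>\<beta>: "\<alpha> u \<in> \<Gamma>" "\<beta> u \<in> \<Gamma>" "\<alpha> u \<noteq> \<beta> u" "u \<in> \<alpha> u" "u \<in> \<beta> u" if "u \<in> outer_vertices" for u
    using p[OF that] by (auto simp: \<alpha>_def \<beta>_def)
  obtain v where v: "v \<in> outer_vertices" using ne by blast
  obtain W0 where W0: "W0 \<in> outer_faces" using jump_at_stretch_ends[OF \<alpha>\<beta>(1) _ \<alpha>\<beta>(4)] v by metis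
  then show "outer_faces \<noteq> {}" by blast
  obtain b0 where b0: "b0 \<in> \<Gamma>" using assms(1) by blast
  have Fc: "F \<noteq> {}" "connected F" "F \<subseteq> - \<Union>\<Gamma>" if "F \<in> outer_faces" for F
    using that in_components_nonempty[of F] in_components_connected[of F] in_components_subset[of F]
    by (auto simp: outer_faces_def)
  then obtain \<rho> where \<rho>: "\<And>F. F \<in> outer_faces \<Longrightarrow> \<rho> F \<in> F"
    by (metis ex_in_conv)
  \<comment> \<open>Choosing the zero branch for \<open>W0\<close> makes its vector
    \<open>D W0\<close> vanish.\<close>
  have "\<exists>L. angle_fun (snd q) (\<rho> (fst q)) (\<rho> W0) L \<and> (fst q = W0 \<longrightarrow> L = (\<lambda>_. 0))"
    if "q \<in> outer_faces \<times> \<Gamma>" for q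
  proof (cases "fst q = W0")
    case True
    then show ?thesis using angle_fun_refl[of 0] by auto
  next
    case False
    then show ?thesis
      using outer_face_angle_fun[OF \<rho> _ \<rho> W0, of "fst q" "snd q"] that W0 by auto
  qed
  then obtain \<Psi>' where \<Psi>': "\<And>q. q \<in> outer_faces \<times> \<Gamma> \<Longrightarrow>
      angle_fun (snd q) (\<rho> (fst q)) (\<rho> W0) (\<Psi>' q) \<and> (fst q = W0 \<longrightarrow> \<Psi>' q = (\<lambda>_. 0))"
    by metis
  define \<Psi> where "\<Psi> F i = \<Psi>' (F, i)" for F i
  have \<Psi>: "angle_fun i (\<rho> F) (\<rho> W0) (\<Psi> F i)" "F = W0 \<Longrightarrow> \<Psi> F i = (\<lambda>_. 0)"
    if "F \<in> outer_faces" "i \<in> \<Gamma>" for F i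
    using \<Psi>'[of "(F, i)"] that by (auto simp: \<Psi>_def)
  define D where "D F u = \<Psi> F (\<alpha> u) u - \<Psi> F (\<beta> u) u" for F u
  define \<phi> where "\<phi> k u = (case k of
      Inl i \<Rightarrow> (if \<alpha> u = i then 1 else 0) - (if \<beta> u = i then 1 else 0) | Inr F \<Rightarrow> D F u)" for k u
  define K where "K = (\<Gamma> - {b0}) <+> (outer_faces - {W0})"
  have finF: "finite outer_faces" by (rule finite_outer_faces[OF assms(1)])
  have "compact (\<Union>\<Gamma>)"
    using finite_curves pseudocircle_Jordan(1)[OF pseudocircle] by (intro compact_Union) auto
  \<comment> \<open>Within a face one branch serves all curves at once, so it cancels in the
    difference of two curves at a vertex.\<close>
  then have global: "\<exists>M. angle_fun (\<Union>\<Gamma>) w w' M" if "F \<in> outer_faces" "w \<in> F" "w' \<in> F" for F w w'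
  proof -
    have "connected_component (- \<Union>\<Gamma>) w w'"
      unfolding connected_component_def using Fc[OF that(1)] that by blast
    moreover have "w \<notin> \<Union>\<Gamma>" "w' \<notin> \<Union>\<Gamma>" using Fc(3)[OF that(1)] that by blast+
    ultimately show ?thesis using angle_fun_exists_iff[OF \<open>compact (\<Union>\<Gamma>)\<close>] by blast
  qed
  have "card outer_vertices \<le> 2 * card K"
  proof (rule card_le_twice_generators[of _ _ \<phi>])
    show "finite outer_vertices" by (rule finite_outer_vertices)
    show "finite K" unfolding K_def using finite_curves finF by simp
    fix v assume v: "v \<in> outer_vertices"
    obtain v' w w' F F' L where v': "v' \<in> outer_vertices" "v' \<noteq> v" and F: "F \<in> outer_faces" "F' \<in> outer_faces"
      and w: "w \<in> F" "w' \<in> F'" and L: "\<And>i. i \<in> \<Gamma> \<Longrightarrow> angle_fun i w w' (L i)"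
      and jump: "\<And>u i j. u \<in> outer_vertices \<Longrightarrow> i \<in> \<Gamma> \<Longrightarrow> j \<in> \<Gamma> \<Longrightarrow> i \<noteq> j \<Longrightarrow> u \<in> i \<Longrightarrow> u \<in> j \<Longrightarrow>
        L i u \<noteq> L j u \<longleftrightarrow> u = v \<or> u = v'"
      by (rule jump_at_stretch_ends[OF \<alpha>\<beta>(1)[OF v] v \<alpha>\<beta>(4)[OF v]]) (rule that; assumption)
    obtain M where M: "angle_fun (\<Union>\<Gamma>) w (\<rho> F) M" using global[OF F(1) w(1) \<rho>[OF F(1)]] by blast
    obtain M' where M': "angle_fun (\<Union>\<Gamma>) (\<rho> F') w' M'" using global[OF F(2) \<rho>[OF F(2)] w(2)] by blast
    have "\<exists>c. \<forall>z\<in>i. L i z = M z + \<Psi> F i z - \<Psi> F' i z + M' z + c" if i: "i \<in> \<Gamma>" for i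
    proof -
      have sub: "i \<subseteq> \<Union>\<Gamma>" using i by blast
      have N: "angle_fun i w w' (\<lambda>z. M z + (\<Psi> F i z + (- \<Psi> F' i z + M' z)))"
        by (intro angle_fun_trans[OF angle_fun_subset[OF M sub]] angle_fun_trans[OF \<Psi>(1)[OF F(1) i]]
            angle_fun_trans[OF angle_fun_sym[OF \<Psi>(1)[OF F(2) i]]] angle_fun_subset[OF M' sub])
      have "w' \<notin> i" using Fc(3)[OF F(2)] w(2) i by blast
      then obtain c where "\<And>z. z \<in> i \<Longrightarrow> L i z = M z + (\<Psi> F i z + (- \<Psi> F' i z + M' z)) + c"
        using angle_fun_unique[OF L[OF i] N pseudocircle_Jordan(2)[OF pseudocircle[OF i]] subset_refl subset_refl]
        by blast
      then show ?thesis by (intro exI[of _ c]) (simp add: algebra_simps)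
    qed
    then obtain c where c: "\<And>i z. i \<in> \<Gamma> \<Longrightarrow> z \<in> i \<Longrightarrow> L i z = M z + \<Psi> F i z - \<Psi> F' i z + M' z + c i"
      by metis
    \<comment> \<open>Subtracting \<open>c b0\<close> from all constants leaves their differences
      unchanged and removes the generator of \<open>b0\<close>.\<close>
    define coeff where "coeff k = (case k of
      Inl i \<Rightarrow> c i - c b0 | Inr G \<Rightarrow> (if F = G then 1 else 0) - (if F' = G then 1 else (0::real)))" for k
    have "(\<Sum>k\<in>K. coeff k * \<phi> k u) = L (\<alpha> u) u - L (\<beta> u) u" if u: "u \<in> outer_vertices" for u
    proof -
      have D0: "D W0 u = 0" using \<Psi>(2)[OF W0] \<alpha>\<beta>[OF u] by (simp add: D_def)
      have "(\<Sum>k\<in>K. coeff k * \<phi> k u) =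
        (\<Sum>i\<in>\<Gamma> - {b0}. (c i - c b0) * ((if \<alpha> u = i then 1 else 0) - (if \<beta> u = i then 1 else 0))) +
        (\<Sum>G\<in>outer_faces - {W0}. ((if F = G then 1 else 0) - (if F' = G then 1 else 0)) * D G u)"
        unfolding K_def using finite_curves finF
        by (subst sum.Plus) (simp_all add: coeff_def \<phi>_def)
      also have "(\<Sum>i\<in>\<Gamma> - {b0}. (c i - c b0) * ((if \<alpha> u = i then 1 else 0) - (if \<beta> u = i then 1 else 0))) =
          (c (\<alpha> u) - c b0) - (c (\<beta> u) - c b0)"
        using \<alpha>\<beta>[OF u] finite_curves
        by (simp only: right_diff_distrib sum_subtractf)
           (simp add: sum_select_nonbase[of \<Gamma> _ "\<lambda>i. c i - c b0"] flip: left_diff_distrib)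
      also have "(\<Sum>G\<in>outer_faces - {W0}. ((if F = G then 1 else 0) - (if F' = G then 1 else 0)) * D G u) =
          D F u - D F' u"
        using F finF D0
        by (subst mult.commute, simp only: right_diff_distrib sum_subtractf)
           (simp add: sum_select_nonbase[of outer_faces _ "\<lambda>G. D G u"])
      also have "(c (\<alpha> u) - c b0) - (c (\<beta> u) - c b0) + (D F u - D F' u) = L (\<alpha> u) u - L (\<beta> u) u"
        using \<alpha>\<beta>[OF u] by (simp add: c D_def)
      finally show ?thesis .
    qed
    then have "\<forall>u\<in>outer_vertices. (\<Sum>k\<in>K. coeff k * \<phi> k u) \<noteq> 0 \<longleftrightarrow> u = v \<or> u = v'"
      using jump \<alpha>\<beta> by simp
    then show "\<exists>v'\<in>outer_vertices. v' \<noteq> v \<and>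
        (\<exists>c. \<forall>u\<in>outer_vertices. (\<Sum>k\<in>K. c k * \<phi> k u) \<noteq> 0 \<longleftrightarrow> u = v \<or> u = v')"
      using v' by blast
  qed
  also have "card K = (card \<Gamma> - 1) + (card outer_faces - 1)"
    unfolding K_def using finite_curves finF b0 W0 by (subst card_Plus) auto
  finally show "card outer_vertices \<le> 2 * ((card \<Gamma> - 1) + (card outer_faces - 1))" .
qed

end

theorem theorem2p5:
  fixes \<Gamma> :: "complex set set" and n :: nat
  assumes "arrangement \<Gamma>" and "card \<Gamma> = n" and "n \<ge> 2"
  shows "int (v0 \<Gamma>) \<le> 2 * int n + 2 * int (f0 \<Gamma>) - 4"
proof -
  interpret pseudocircle_arrangement \<Gamma> by unfold_locales (rule assms(1))
  have ne: "\<Gamma> \<noteq> {}" using assms by auto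
  show ?thesis
  \<comment> \<open>Without outer vertices \<open>n \<ge> 2\<close> makes the right-hand side
    nonnegative. Otherwise an outer face exists, so the truncated subtraction
    \<open>card outer_faces - 1\<close> is exact.\<close>
  proof (cases "outer_vertices = {}")
    case True
    then show ?thesis using assms by (simp add: v0_eq)
  next
    case False
    have "card outer_faces \<noteq> 0"
      using card_outer_vertices_le(1)[OF ne False] finite_outer_faces[OF ne] by simp
    then show ?thesis
      using card_outer_vertices_le(2)[OF ne False] assms(2,3) by (simp add: v0_eq f0_eq)
  qed
qed

end
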